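(* (a) Let $1\leq n\leq 4$ and $r\geq 0$ be integers. Then $L_n^{\langle r\rangle}(x)=\sum_{j=0}^{n}\binom{n-j+r}{n-j}\frac{x^j}{j!}$ is irreducible over $\mathbb{Q}$ and its Galois group over $\mathbb{Q}$ contains $A_n$; if $n\leq 3$, this Galois group is the full symmetric group $S_n$. (b) For each $n\in\{2,3,4\}$ there exist infinitely many rational numbers $\alpha$ such that $L_n^{(\alpha)}(x)$ is reducible over $\mathbb{Q}$. (c) There exist infinitely many rational numbers $\alpha$ such that $L_4^{(\alpha)}(x)$ is irreducible over $\mathbb{Q}$ and its Galois group over $\mathbb{Q}$ does not contain $A_4$.
   Context: For rational $\alpha$, $L_n^{(\alpha)}(x)=(-1)^n\sum_{j=0}^n\binom{n+\alpha}{n-j}\frac{(-x)^j}{j!}$, where $\binom{t}{k}=t(t-1)\cdots(t-k+1)/k!$. Note $L_n^{\langle r\rangle}(x)=L_n^{(-1-n-r)}(x)$. Galois groups are viewed as permutation groups on the roots. *)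

theory Defs
  imports
    "HOL-Algebra.Algebraic_Closure_Type"
    "HOL-Algebra.Generated_Fields"
    "HOL-Combinatorics.Permutations"
    "HOL-Computational_Algebra.Computational_Algebra"
    Complex_Main
begin

definition gen_laguerre :: "nat \<Rightarrow> rat \<Rightarrow> rat poly" where
  "gen_laguerre n \<alpha> =
     smult ((-1) ^ n)
       (\<Sum>j\<le>n. smult (((of_nat n + \<alpha>) gchoose (n - j)) / fact j) ([:0, -1:] ^ j))"

definition laguerre_r :: "nat \<Rightarrow> nat \<Rightarrow> rat poly" where
  "laguerre_r n r = gen_laguerre n (- 1 - of_nat n - of_nat r)"

definition complex_roots :: "rat poly \<Rightarrow> complex set" where
  "complex_roots p = {z. poly (map_poly of_rat p) z = 0}"

text \<open>The splitting field is taken inside the complex numbers; since the complex numbers are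
  algebraically closed, the field generated by the rationals and the roots is a splitting field.\<close>

definition splitting_field :: "rat poly \<Rightarrow> complex ring" where
  "splitting_field p =
     ring_of_type_algebra
       \<lparr>carrier := generate_field ring_of_type_algebra (\<rat> \<union> complex_roots p)\<rparr>"

text \<open>An element of \<open>field_auts\<close> is a total function on the complex numbers, constrained
  only on the splitting field.\<close>

definition field_auts :: "rat poly \<Rightarrow> (complex \<Rightarrow> complex) set" where
  "field_auts p =
     {\<sigma> \<in> ring_iso (splitting_field p) (splitting_field p). \<forall>q\<in>\<rat>. \<sigma> q = q}"

text \<open>The Galois group as a permutation group on the roots. As usual for \<^const>\<open>permutes\<close>,
  permutations of the roots are extended by the identity.\<close>

definition galois_group :: "rat poly \<Rightarrow> (complex \<Rightarrow> complex) set" where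
  "galois_group p =
     (\<lambda>\<sigma> z. if z \<in> complex_roots p then \<sigma> z else z) ` field_auts p"

definition symmetric_on :: "'a set \<Rightarrow> ('a \<Rightarrow> 'a) set" where
  "symmetric_on S = {\<pi>. \<pi> permutes S}"

definition alternating_on :: "'a set \<Rightarrow> ('a \<Rightarrow> 'a) set" where
  "alternating_on S = {\<pi>. \<pi> permutes S \<and> evenperm \<pi>}"

end

theory Submission
  imports Defs
begin

text \<open>With \<open>c = - \<alpha> - n\<close> and \<open>y = x + c\<close>, the polynomial \<open>n! L\<^sub>n\<close> becomes
  \<open>y\<^sup>2 + c\<close>, \<open>y\<^sup>3 + 3cy + 2c\<close> and \<open>y\<^sup>4 + 6cy\<^sup>2 + 8cy + 3c\<^sup>2 + 6c\<close> for
  \<open>n = 2, 3, 4\<close>; in part (a), \<open>c = r + 1\<close> is a positive integer.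
  Complex conjugation is a transposition for \<open>n = 2, 3\<close>, so transitivity gives the full symmetric group.
  For \<open>n = 4\<close> the cubic resolvent \<open>2w\<^sup>3 + 6cw\<^sup>2 + 3c(c - 1)w - 2c\<^sup>2\<close>, whose roots are
  the numbers \<open>(x\<^sub>1 + x\<^sub>2 - x\<^sub>3 - x\<^sub>4)\<^sup>2 / 16\<close>, controls everything: the quartic
  splits into quadratics over the rationals when a root \<open>w\<close> is a nonzero rational square;
  if the resolvent is irreducible, some automorphism permutes the three pairings of the roots cyclically
  and hence is a 3-cycle; if it has a rational root but the quartic is irreducible, the group
  contains no 3-cycle. The resolvent is quadratic in \<open>c\<close>, with discriminant
  \<open>w\<^sup>2 (12w\<^sup>2 - 20w + 9)\<close>. For \<open>w = z\<^sup>2\<close> this leads to an elliptic curve of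
  positive rank, which gives (b) for \<open>n = 4\<close>; the conic \<open>s\<^sup>2 = 12w\<^sup>2 - 20w + 9\<close> gives (c).
  Automorphisms are obtained by extending embeddings into the complex numbers one root at a time.\<close>

subsection \<open>Transitive permutation groups on three and four points\<close>

text \<open>The quartic criterion rests on one elimination: a factorization (y^2 + a y + b) (y^2 - a
  y + d) leaves, once b and d are removed, the resolvent equation for w = a^2 / 4. Reducibility thus
  asks whether a root w is a rational square, once c > 0 has excluded linear factors. Origin of the
  curve: for w = z^2 the discriminant condition reads s^2 = 12 z^4 - 20 z^2 + 9, which has the point
  (0, 3). The maps z = 6 x / y and s = 3 (x^2 + 32) / (x^2 + 40 x - 32) carry y^2 = x (x^2 + 40 x -
  32) to it. Neither the group law nor a bound on torsion is needed to get infinitely many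
  parameters: the doubling formula alone lowers the 2-adic valuation of x from -2k to -2k - 2, and
  the valuations of the resulting c tell them apart. On the Galois side, an embedding of an
  intermediate field into the complex numbers need not preserve that field; it becomes an
  automorphism only on the splitting field, because it permutes the finite set of roots.\<close>

definition three_cycle :: "'a \<Rightarrow> 'a \<Rightarrow> 'a \<Rightarrow> 'a \<Rightarrow> 'a" where
  "three_cycle x y z = transpose x y \<circ> transpose y z"

lemma three_cycle_apply:
  assumes "x \<noteq> y" "y \<noteq> z" "x \<noteq> z"
  shows "three_cycle x y z x = y" "three_cycle x y z y = z" "three_cycle x y z z = x"
    "w \<notin> {x, y, z} \<Longrightarrow> three_cycle x y z w = w"
  using assms by (auto simp: three_cycle_def transpose_def)

lemma three_cycle_rotate:
  assumes "x \<noteq> y" "y \<noteq> z" "x \<noteq> z"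
  shows "three_cycle x y z = three_cycle y z x"
  using assms by (auto simp: three_cycle_def transpose_def fun_eq_iff)

lemma evenperm_three_cycle: "x \<noteq> y \<Longrightarrow> y \<noteq> z \<Longrightarrow> evenperm (three_cycle x y z)"
  by (simp add: three_cycle_def evenperm_comp evenperm_swap permutation_swap_id)

lemma three_cycle_permutes: "x \<in> S \<Longrightarrow> y \<in> S \<Longrightarrow> z \<in> S \<Longrightarrow> three_cycle x y z permutes S"
  by (simp add: three_cycle_def permutes_compose permutes_swap_id)

lemma inv_three_cycle: "Hilbert_Choice.inv (three_cycle x y z) = three_cycle z y x"
  unfolding three_cycle_def by (subst o_inv_distrib) (auto simp: transpose_commute)

lemma transpose_conj:
  assumes "bij g" shows "g \<circ> transpose x y \<circ> Hilbert_Choice.inv g = transpose (g x) (g y)"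
proof
  fix z
  obtain w where z: "z = g w" using assms by (metis bij_pointE)
  have "inj g" using assms by (rule bij_is_inj)
  then show "(g \<circ> transpose x y \<circ> Hilbert_Choice.inv g) z = transpose (g x) (g y) z"
    by (simp add: z transpose_def inj_eq)
qed

lemma three_cycle_conj:
  assumes "bij g" shows "g \<circ> three_cycle x y z \<circ> Hilbert_Choice.inv g = three_cycle (g x) (g y) (g z)"
proof -
  have "inj g" using assms by (rule bij_is_inj)
  then have "g \<circ> three_cycle x y z \<circ> Hilbert_Choice.inv g
      = (g \<circ> transpose x y \<circ> Hilbert_Choice.inv g) \<circ> (g \<circ> transpose y z \<circ> Hilbert_Choice.inv g)"
    by (simp add: three_cycle_def fun_eq_iff)
  then show ?thesis using assms by (simp add: transpose_conj three_cycle_def)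
qed

locale transitive_perm_group =
  fixes S :: "'a set" and G :: "('a \<Rightarrow> 'a) set"
  assumes permutes: "g \<in> G \<Longrightarrow> g permutes S"
    and id_mem: "id \<in> G"
    and comp_mem: "g \<in> G \<Longrightarrow> h \<in> G \<Longrightarrow> g \<circ> h \<in> G"
    and inv_mem: "g \<in> G \<Longrightarrow> Hilbert_Choice.inv g \<in> G"
    and transitive: "x \<in> S \<Longrightarrow> y \<in> S \<Longrightarrow> \<exists>g\<in>G. g x = y"
begin

lemma bij: "g \<in> G \<Longrightarrow> bij g"
  using permutes permutes_bij by blast

lemma transpose_image: "g \<in> G \<Longrightarrow> transpose x y \<in> G \<Longrightarrow> transpose (g x) (g y) \<in> G"
  by (metis bij comp_mem inv_mem transpose_conj)

lemma three_cycle_image: "g \<in> G \<Longrightarrow> three_cycle x y z \<in> G \<Longrightarrow> three_cycle (g x) (g y) (g z) \<in> G"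
  by (metis bij comp_mem inv_mem three_cycle_conj)

lemma symmetric_of_transpositions:
  assumes "finite S" "\<And>x y. x \<in> S \<Longrightarrow> y \<in> S \<Longrightarrow> x \<noteq> y \<Longrightarrow> transpose x y \<in> G"
  shows "G = symmetric_on S"
proof
  show "G \<subseteq> symmetric_on S" using permutes by (auto simp: symmetric_on_def)
  show "symmetric_on S \<subseteq> G"
  proof
    fix p assume "p \<in> symmetric_on S"
    then have "p permutes S" by (simp add: symmetric_on_def)
    then show "p \<in> G" using assms(1) proof (induction rule: permutes_induct)
      case id show ?case by (rule id_mem)
    next
      case (swap a b p) then show ?case by (intro comp_mem assms(2))
    qed
  qed
qed

text \<open>Conjugating the given transposition by an element that sends \<open>z\<close> to
  \<open>w\<close> yields a transposition whose missing point is \<open>w\<close>. On three points a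
  transposition is determined by the point it misses, so every transposition arises.\<close>

lemma symmetric_3:
  assumes S: "S = {x, y, z}" and t: "transpose x y \<in> G" and dist: "distinct [x, y, z]"
  shows "G = symmetric_on S"
proof (rule symmetric_of_transpositions)
  show "finite S" using S by simp
  have missing: "\<exists>p q. distinct [p, q, w] \<and> p \<in> S \<and> q \<in> S \<and> transpose p q \<in> G" if w: "w \<in> S" for w
  proof -
    obtain g where g: "g \<in> G" "g z = w" using transitive[of z w] w S by auto
    have "inj g" using bij g bij_is_inj by blast
    moreover have "g x \<in> S" "g y \<in> S" using permutes_in_image[OF permutes[OF g(1)]] S by auto
    ultimately show ?thesis using transpose_image[OF g(1) t] dist
      by (intro exI[of _ "g x"] exI[of _ "g y"]) (auto simp: inj_eq g(2)[symmetric])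
  qed
  show "transpose u v \<in> G" if uv: "u \<in> S" "v \<in> S" "u \<noteq> v" for u v
  proof -
    obtain w where w: "w \<in> S" "w \<noteq> u" "w \<noteq> v" using S dist uv by auto
    obtain p q where pq: "distinct [p, q, w]" "p \<in> S" "q \<in> S" "transpose p q \<in> G"
      using missing[OF w(1)] by blast
    have "{u, v, w} = S" by (rule card_subset_eq) (use S dist uv w in auto)
    then have "(p, q) \<in> {(u, v), (v, u)}" using pq uv w by auto
    then show ?thesis using pq(4) by (auto simp: transpose_commute)
  qed
qed

text \<open>By transitivity the fixed point of the given 3-cycle can be moved to any point
  \<open>w\<close>; the conjugate and its inverse are the only two 3-cycles fixing \<open>w\<close>,
  so \<open>G\<close> contains all 3-cycles. An even permutation is then reduced to the identity by
  even corrections from \<open>G\<close>.\<close>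

lemma alternating_4:
  assumes S: "S = {a, b, c, d}" and dist: "distinct [a, b, c, d]"
    and t: "three_cycle x0 y0 z0 \<in> G" and xyz: "{x0, y0, z0} \<subseteq> S" "distinct [x0, y0, z0]"
  shows "alternating_on S \<subseteq> G"
proof -
  have cardS: "card S = 4" "finite S" using S dist by simp_all
  have ex3: "\<exists>z\<in>S. z \<noteq> u \<and> z \<noteq> v \<and> z \<noteq> w" for u v w
  proof (rule ccontr)
    assume "\<not> ?thesis"
    then have "S \<subseteq> {u, v, w}" by auto
    then have "card S \<le> card {u, v, w}" by (simp add: card_mono)
    also have "\<dots> \<le> 3" by (simp add: card_insert_if)
    finally show False using cardS by simp
  qed
  obtain w0 where w0: "w0 \<in> S" "w0 \<noteq> x0" "w0 \<noteq> y0" "w0 \<noteq> z0" using ex3 by blast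
  have all: "three_cycle x y z \<in> G" if xs: "{x, y, z} \<subseteq> S" "distinct [x, y, z]" for x y z
  proof -
    obtain w where w: "w \<in> S" "w \<noteq> x" "w \<noteq> y" "w \<noteq> z" using ex3 by blast
    have "{w, x, y, z} = S" using w xs cardS by (intro card_subset_eq) auto
    obtain g where g: "g \<in> G" "g w0 = w" using transitive[OF w0(1) w(1)] by auto
    define p q r where "p = g x0" and "q = g y0" and "r = g z0"
    have "inj g" using bij g bij_is_inj by blast
    then have pqr: "distinct [p, q, r, w]"
      using w0 xyz by (auto simp: p_def q_def r_def g(2)[symmetric] inj_eq)
    have "{p, q, r} \<subseteq> S" using permutes[OF g(1)] xyz by (simp add: permutes_in_image p_def q_def r_def)
    have pG: "three_cycle p q r \<in> G" using three_cycle_image[OF g(1) t] by (simp add: p_def q_def r_def)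
    have rG: "three_cycle r q p \<in> G" using inv_mem[OF pG] by (simp add: inv_three_cycle)
    have "(x, y, z) \<in> {(p,q,r),(q,r,p),(r,p,q),(r,q,p),(q,p,r),(p,r,q)}"
      using \<open>{p, q, r} \<subseteq> S\<close> \<open>{w, x, y, z} = S\<close>[symmetric] pqr xs w by auto
    then show ?thesis
      using pG rG three_cycle_rotate[of p q r] three_cycle_rotate[of q r p]
        three_cycle_rotate[of r q p] three_cycle_rotate[of q p r] pqr by auto
  qed
  \<comment> \<open>The point \<open>w\<close> is one that an earlier correction has already
    settled; the auxiliary \<open>z\<close> is chosen away from it, so that the 3-cycle leaves it
    alone.\<close>
  have move: "\<exists>h\<in>G. evenperm h \<and> h u = v \<and> (w \<notin> {u, v} \<longrightarrow> h w = w)" if uv: "u \<in> S" "v \<in> S" for u v w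
  proof (cases "u = v")
    case True then show ?thesis by (intro bexI[OF _ id_mem]) simp
  next
    case False
    obtain z where z: "z \<in> S" "z \<noteq> u" "z \<noteq> v" "z \<noteq> w" using ex3 by blast
    then show ?thesis using all[of u v z] False uv
      by (intro bexI[of _ "three_cycle u v z"]) (auto simp: three_cycle_apply evenperm_three_cycle)
  qed
  show ?thesis
  proof
    fix p assume "p \<in> alternating_on S"
    then have p: "p permutes S" "evenperm p" by (auto simp: alternating_on_def)
    have ev: "evenperm (h \<circ> p) \<and> h \<circ> p permutes S" if "h \<in> G" "evenperm h" "p permutes S" "evenperm p" for h p
    proof -
      have "permutation h" "permutation p" using that permutes cardS(2) permutation_permutes by blast+
      then show ?thesis using that permutes[of h] by (simp add: evenperm_comp permutes_compose)
    qed
    have memS: "p u \<in> S" if "p permutes S" "u \<in> S" for p u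
      using that by (simp add: permutes_in_image)
    obtain h1 where h1: "h1 \<in> G" "evenperm h1" "h1 (p a) = a" using move[of "p a" a a] S memS[OF p(1)] by auto
    define p1 where "p1 = h1 \<circ> p"
    have p1: "p1 permutes S" "evenperm p1" "p1 a = a" using ev[OF h1(1,2) p] h1(3) by (auto simp: p1_def)
    have ne: "a \<notin> {p1 b, b}" using p1 dist permutes_inj[OF p1(1)] by (auto dest: injD)
    obtain h2 where h2: "h2 \<in> G" "evenperm h2" "h2 (p1 b) = b" "h2 a = a"
      using move[of "p1 b" b a] S memS[OF p1(1)] ne by auto
    define p2 where "p2 = h2 \<circ> p1"
    have p2: "p2 permutes S" "evenperm p2" "p2 a = a" "p2 b = b"
      using ev[OF h2(1,2) p1(1,2)] h2(3,4) p1(3) by (auto simp: p2_def)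
    \<comment> \<open>Only the identity and the swap of \<open>c\<close> and \<open>d\<close>
      remain, and evenness excludes the swap.\<close>
    have "p2 permutes {c, d}" by (rule permutes_superset[OF p2(1)]) (use S p2 in auto)
    then have "p2 = id" using p2(2) dist by (auto simp: permutes_doubleton_iff evenperm_swap)
    then have "p = Hilbert_Choice.inv h1 \<circ> Hilbert_Choice.inv h2"
      using bij[OF h1(1)] bij[OF h2(1)] unfolding p2_def p1_def
      by (metis (no_types, lifting) bij_is_inj comp_assoc comp_id fun.map_id inv_o_cancel o_inv_distrib bij_comp)
    then show "p \<in> G" using comp_mem inv_mem h1 h2 by simp
  qed
qed
end

subsection \<open>Embeddings of subfields of the complex numbers\<close>

locale complex_embedding =
  fixes F :: "complex set" and \<sigma> :: "complex \<Rightarrow> complex"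
  assumes one_closed: "1 \<in> F"
    and diff_closed: "x \<in> F \<Longrightarrow> y \<in> F \<Longrightarrow> x - y \<in> F"
    and mult_closed: "x \<in> F \<Longrightarrow> y \<in> F \<Longrightarrow> x * y \<in> F"
    and inverse_closed: "x \<in> F \<Longrightarrow> inverse x \<in> F"
    and hom_one: "\<sigma> 1 = 1"
    and hom_add: "x \<in> F \<Longrightarrow> y \<in> F \<Longrightarrow> \<sigma> (x + y) = \<sigma> x + \<sigma> y"
    and hom_mult: "x \<in> F \<Longrightarrow> y \<in> F \<Longrightarrow> \<sigma> (x * y) = \<sigma> x * \<sigma> y"
begin

lemma zero_closed: "0 \<in> F"
  using diff_closed[OF one_closed one_closed] by simp

lemma uminus_closed: "x \<in> F \<Longrightarrow> - x \<in> F"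
  using diff_closed[OF zero_closed] by fastforce

lemma add_closed: "x \<in> F \<Longrightarrow> y \<in> F \<Longrightarrow> x + y \<in> F"
  using diff_closed[OF _ uminus_closed] by fastforce

lemma divide_closed: "x \<in> F \<Longrightarrow> y \<in> F \<Longrightarrow> x / y \<in> F"
  by (simp add: divide_inverse mult_closed inverse_closed)

lemma sum_closed: "(\<And>i. i \<in> A \<Longrightarrow> f i \<in> F) \<Longrightarrow> sum f A \<in> F"
  by (induction A rule: infinite_finite_induct) (auto intro: zero_closed add_closed)

lemma hom_zero: "\<sigma> 0 = 0"
  using hom_add[OF zero_closed zero_closed] by simp

lemma hom_uminus: "x \<in> F \<Longrightarrow> \<sigma> (- x) = - \<sigma> x"
  using hom_add[of x "- x"] uminus_closed hom_zero by (simp add: eq_neg_iff_add_eq_0 add.commute)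

lemma hom_diff: "x \<in> F \<Longrightarrow> y \<in> F \<Longrightarrow> \<sigma> (x - y) = \<sigma> x - \<sigma> y"
  using hom_add[of x "- y"] uminus_closed hom_uminus by simp

lemma hom_power: "x \<in> F \<Longrightarrow> x ^ n \<in> F \<and> \<sigma> (x ^ n) = \<sigma> x ^ n"
  by (induction n) (auto simp: one_closed hom_one mult_closed hom_mult)

lemma hom_sum: "(\<And>i. i \<in> A \<Longrightarrow> f i \<in> F) \<Longrightarrow> \<sigma> (sum f A) = (\<Sum>i\<in>A. \<sigma> (f i))"
  by (induction A rule: infinite_finite_induct) (auto simp: hom_zero hom_add sum_closed)

lemma hom_eq_0_iff: "x \<in> F \<Longrightarrow> \<sigma> x = 0 \<longleftrightarrow> x = 0"
  using hom_mult[of x "inverse x"] hom_one hom_zero inverse_closed[of x] by (cases "x = 0") auto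

lemma hom_inj: "inj_on \<sigma> F"
  using hom_eq_0_iff hom_diff diff_closed by (intro inj_onI) (metis right_minus_eq)

lemma hom_inverse: "x \<in> F \<Longrightarrow> \<sigma> (inverse x) = inverse (\<sigma> x)"
  using hom_mult[of x "inverse x"] hom_one hom_zero inverse_closed[of x] hom_eq_0_iff[of x]
  by (cases "x = 0") (auto simp: field_simps)

lemma nat_closed: "of_nat n \<in> F" and hom_of_nat: "\<sigma> (of_nat n) = of_nat n"
proof -
  have "of_nat n \<in> F \<and> \<sigma> (of_nat n) = of_nat n"
    by (induction n) (auto simp: zero_closed hom_zero add_closed hom_add one_closed hom_one)
  then show "of_nat n \<in> F" "\<sigma> (of_nat n) = of_nat n" by auto
qed

lemma int_closed: "of_int n \<in> F" and hom_of_int: "\<sigma> (of_int n) = of_int n"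
  by (cases n; auto simp: nat_closed hom_of_nat uminus_closed hom_uminus simp del: of_nat_Suc)+

lemma rat_closed: "of_rat q \<in> F" and hom_of_rat: "\<sigma> (of_rat q) = of_rat q"
proof -
  obtain a b where "quotient_of q = (a, b)" by (cases "quotient_of q")
  then have "q = of_int a / of_int b" by (rule quotient_of_div)
  then have q: "(of_rat q :: complex) = of_int a * inverse (of_int b)"
    by (simp add: of_rat_divide flip: divide_inverse)
  show "of_rat q \<in> F" "\<sigma> (of_rat q) = of_rat q"
    unfolding q by (simp_all add: mult_closed inverse_closed int_closed hom_mult hom_inverse hom_of_int)
qed

lemma Rats_closed: "\<rat> \<subseteq> F" and hom_Rats: "q \<in> \<rat> \<Longrightarrow> \<sigma> q = q"
  by (auto elim!: Rats_cases simp: rat_closed hom_of_rat)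

section \<open>Polynomials with coefficients in a subfield\<close>

definition poly_over :: "complex poly \<Rightarrow> bool" where
  "poly_over p \<longleftrightarrow> (\<forall>i. coeff p i \<in> F)"

lemma poly_over_0: "poly_over 0" and poly_over_1: "poly_over 1"
  by (auto simp: poly_over_def zero_closed coeff_1 one_closed)

lemma poly_over_add: "poly_over p \<Longrightarrow> poly_over q \<Longrightarrow> poly_over (p + q)"
  and poly_over_diff: "poly_over p \<Longrightarrow> poly_over q \<Longrightarrow> poly_over (p - q)"
  and poly_over_uminus: "poly_over p \<Longrightarrow> poly_over (- p)"
  and poly_over_mult: "poly_over p \<Longrightarrow> poly_over q \<Longrightarrow> poly_over (p * q)"
  and poly_over_const: "x \<in> F \<Longrightarrow> poly_over [:x:]"
  and poly_over_monom: "x \<in> F \<Longrightarrow> poly_over (Polynomial.monom x n)"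
  and poly_over_pCons: "x \<in> F \<Longrightarrow> poly_over p \<Longrightarrow> poly_over (pCons x p)"
  by (auto simp: poly_over_def add_closed diff_closed uminus_closed coeff_mult mult_closed
      zero_closed coeff_pCons intro!: sum_closed split: nat.split)

lemma poly_over_of_rat: "poly_over (map_poly of_rat p)"
  by (simp add: poly_over_def coeff_map_poly rat_closed)

abbreviation hom_poly :: "complex poly \<Rightarrow> complex poly" where
  "hom_poly \<equiv> map_poly \<sigma>"

lemma coeff_hom_poly: "coeff (hom_poly p) i = \<sigma> (coeff p i)"
  by (simp add: coeff_map_poly hom_zero)

lemma hom_poly_add: "poly_over p \<Longrightarrow> poly_over q \<Longrightarrow> hom_poly (p + q) = hom_poly p + hom_poly q"
  and hom_poly_diff: "poly_over p \<Longrightarrow> poly_over q \<Longrightarrow> hom_poly (p - q) = hom_poly p - hom_poly q"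
  and hom_poly_mult: "poly_over p \<Longrightarrow> poly_over q \<Longrightarrow> hom_poly (p * q) = hom_poly p * hom_poly q"
  and hom_poly_const: "hom_poly [:x:] = [:\<sigma> x:]"
  and hom_poly_of_rat: "hom_poly (map_poly of_rat r) = map_poly of_rat r"
  by (auto simp: poly_eq_iff coeff_hom_poly poly_over_def hom_add hom_diff coeff_mult hom_sum
      hom_mult mult_closed hom_zero coeff_pCons coeff_map_poly hom_of_rat intro!: sum.cong split: nat.split)

lemma hom_poly_eval:
  assumes "poly_over p" "x \<in> F" shows "\<sigma> (poly p x) = poly (hom_poly p) (\<sigma> x)" "poly p x \<in> F"
proof -
  have "poly p x \<in> F \<and> \<sigma> (poly p x) = poly (hom_poly p) (\<sigma> x)"
    using assms(1)
  proof (induction p)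
    case 0 then show ?case by (simp add: zero_closed hom_zero)
  next
    case (pCons a p)
    have "a \<in> F" using pCons.prems by (auto simp: poly_over_def dest: spec[of _ 0])
    moreover have "poly_over p" using pCons.prems unfolding poly_over_def by (metis coeff_pCons_Suc)
    ultimately show ?case using pCons assms(2)
      by (simp add: map_poly_pCons hom_zero add_closed mult_closed hom_add hom_mult)
  qed
  then show "\<sigma> (poly p x) = poly (hom_poly p) (\<sigma> x)" "poly p x \<in> F" by auto
qed

lemma poly_over_division:
  assumes "poly_over g" "poly_over m" "m \<noteq> 0"
  shows "\<exists>q r. poly_over q \<and> poly_over r \<and> g = q * m + r \<and> (r = 0 \<or> degree r < degree m)"
  using assms(1)
proof (induction "degree g" arbitrary: g rule: less_induct)
  case less
  show ?case
  proof (cases "g = 0 \<or> degree g < degree m")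
    case True
    then show ?thesis using less.prems poly_over_0 by (intro exI[of _ 0] exI[of _ g]) auto
  next
    case False
    define t where "t = Polynomial.monom (lead_coeff g / lead_coeff m) (degree g - degree m)"
    have t: "poly_over t" using less.prems assms(2) unfolding t_def
      by (intro poly_over_monom divide_closed) (auto simp: poly_over_def)
    define g' where "g' = g - t * m"
    have g': "poly_over g'" using less.prems t assms(2) by (simp add: g'_def poly_over_diff poly_over_mult)
    have t0: "t \<noteq> 0" using False assms(3) by (simp add: t_def)
    have "degree (t * m) = degree g"
      using False assms(3) t0 by (simp add: degree_mult_eq t_def degree_monom_eq)
    moreover have "lead_coeff (t * m) = lead_coeff g"
      unfolding lead_coeff_mult using False assms(3) by (simp add: t_def degree_monom_eq)
    ultimately have "g' = 0 \<or> degree g' < degree g"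
      unfolding g'_def by (intro eq_zero_or_degree_less degree_diff_le) simp_all
    then show ?thesis
    proof
      assume "g' = 0"
      then show ?thesis using t poly_over_0 by (intro exI[of _ t] exI[of _ 0]) (simp add: g'_def)
    next
      assume "degree g' < degree g"
      from less.hyps[OF this g'] obtain q r where
        "poly_over q" "poly_over r" "g' = q * m + r" "r = 0 \<or> degree r < degree m" by blast
      then show ?thesis using t
        by (intro exI[of _ "q + t"] exI[of _ r]) (auto simp: g'_def poly_over_add algebra_simps)
    qed
  qed
qed

section \<open>Minimal polynomials and extension of embeddings\<close>

definition min_poly_of :: "complex \<Rightarrow> complex poly \<Rightarrow> bool" where
  "min_poly_of z m \<longleftrightarrow> poly_over m \<and> m \<noteq> 0 \<and> poly m z = 0 \<and>
     (\<forall>g. poly_over g \<and> g \<noteq> 0 \<and> poly g z = 0 \<longrightarrow> degree m \<le> degree g)"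

lemma min_poly_exists:
  assumes "poly_over p" "p \<noteq> 0" "poly p z = 0"
  shows "\<exists>m. min_poly_of z m"
proof -
  let ?P = "\<lambda>g. poly_over g \<and> g \<noteq> 0 \<and> poly g z = 0"
  have "?P (arg_min degree ?P) \<and> (\<forall>g. ?P g \<longrightarrow> degree (arg_min degree ?P) \<le> degree g)"
    by (rule arg_min_nat_lemma[of ?P p]) (use assms in simp)
  then show ?thesis by (auto simp: min_poly_of_def)
qed

lemma min_poly_dvd:
  assumes m: "min_poly_of z m" and g: "poly_over g" "poly g z = 0"
  shows "\<exists>q. poly_over q \<and> g = q * m"
proof -
  have m': "poly_over m" "m \<noteq> 0" "poly m z = 0" using m by (auto simp: min_poly_of_def)
  obtain q r where qr: "poly_over q" "poly_over r" "g = q * m + r" "r = 0 \<or> degree r < degree m"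
    using poly_over_division[OF g(1) m'(1,2)] by blast
  have "poly r z = 0" using g(2) m'(3) qr(3) by simp
  then have "r = 0" using qr m unfolding min_poly_of_def by (metis not_le)
  then show ?thesis using qr by auto
qed

text \<open>Euclid's algorithm evaluated at \<open>z\<close>. A \<open>g\<close> of large degree is
  replaced by its remainder modulo \<open>m\<close>. Otherwise \<open>m\<close> =
  \<open>q * g + r\<close> gives r(z) = - q(z) g(z), and an inverse of r(z) yields one of g(z). Here
  r(z) is nonzero: else \<open>r\<close> = 0 and q(z) = 0 with \<open>q\<close> of smaller degree
  than \<open>m\<close>, against minimality.\<close>

lemma min_poly_inverse:
  assumes m: "min_poly_of z m" and g: "poly_over g" "poly g z \<noteq> 0"
  shows "\<exists>h. poly_over h \<and> poly h z * poly g z = 1"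
  using g
proof (induction "degree g" arbitrary: g rule: less_induct)
  case less
  have m': "poly_over m" "m \<noteq> 0" "poly m z = 0" using m by (auto simp: min_poly_of_def)
  have g0: "g \<noteq> 0" using less.prems by auto
  consider "degree g = 0" | "degree m \<le> degree g" "degree g \<noteq> 0" | "degree g < degree m" "degree g \<noteq> 0"
    by linarith
  then show ?case
  proof cases
    case 1
    then obtain x where x: "g = [:x:]" by (metis degree_eq_zeroE)
    then have "x \<in> F" using less.prems(1) by (auto simp: poly_over_def dest: spec[of _ 0])
    then show ?thesis using x less.prems
      by (intro exI[of _ "[:inverse x:]"]) (auto simp: poly_over_const inverse_closed)
  next
    case 2
    obtain q r where qr: "poly_over q" "poly_over r" "g = q * m + r" "r = 0 \<or> degree r < degree m"
      using poly_over_division[OF less.prems(1) m'(1,2)] by blast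
    have "poly r z = poly g z" using qr(3) m'(3) by simp
    then show ?thesis using less.hyps[OF _ qr(2)] less.prems(2) qr(4) 2 by fastforce
  next
    case 3
    obtain q r where qr: "poly_over q" "poly_over r" "m = q * g + r" "r = 0 \<or> degree r < degree g"
      using poly_over_division[OF m'(1) less.prems(1) g0] by blast
    have rz: "poly r z = - poly q z * poly g z" using m'(3) qr(3) by (simp add: eq_neg_iff_add_eq_0 add.commute)
    have "poly r z \<noteq> 0"
    proof
      assume r: "poly r z = 0"
      then have "r = 0" using qr(2,4) 3 m by (force simp: min_poly_of_def)
      then have mq: "m = q * g" using qr(3) by simp
      then have q0: "q \<noteq> 0" using m'(2) by auto
      have "poly q z = 0" using rz r less.prems(2) by simp
      then have "degree m \<le> degree q" using m qr(1) q0 by (auto simp: min_poly_of_def)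
      then show False using 3 q0 g0 by (simp add: mq degree_mult_eq)
    qed
    then obtain h where h: "poly_over h" "poly h z * poly r z = 1"
      using less.hyps[OF _ qr(2)] qr(4) by auto
    then show ?thesis using rz qr(1)
      by (intro exI[of _ "- h * q"]) (auto simp: poly_over_mult poly_over_uminus mult.assoc)
  qed
qed

text \<open>The extension sends g(z) to the value at \<open>z'\<close> of the image of
  \<open>g\<close>. Two representatives of the same element differ by a multiple of
  \<open>m\<close>, whose image vanishes at \<open>z'\<close>, so the choice made by
  \<open>SOME\<close> is immaterial.\<close>

lemma extend:
  assumes m: "min_poly_of z m" and z': "poly (hom_poly m) z' = 0"
  shows "\<exists>F' \<tau>. complex_embedding F' \<tau> \<and> F \<subseteq> F' \<and> z \<in> F' \<and> \<tau> z = z' \<and> (\<forall>x\<in>F. \<tau> x = \<sigma> x)"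
proof -
  define F' where "F' = {poly g z | g. poly_over g}"
  define \<tau> where "\<tau> w = poly (hom_poly (SOME g. poly_over g \<and> poly g z = w)) z'" for w
  have \<tau>: "\<tau> (poly g z) = poly (hom_poly g) z'" if g: "poly_over g" for g
  proof -
    define h where "h = (SOME h. poly_over h \<and> poly h z = poly g z)"
    have h: "poly_over h" "poly h z = poly g z"
      using someI[of "\<lambda>h. poly_over h \<and> poly h z = poly g z" g] g by (auto simp: h_def)
    obtain q where q: "poly_over q" "h - g = q * m"
      using min_poly_dvd[OF m poly_over_diff[OF h(1) g]] h(2) by auto
    have "hom_poly h - hom_poly g = hom_poly q * hom_poly m"
      using hom_poly_diff[OF h(1) g] hom_poly_mult[of q m] q m by (simp add: min_poly_of_def)
    then have "poly (hom_poly h) z' - poly (hom_poly g) z' = 0"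
      using z' by (metis mult_zero_right poly_diff poly_mult)
    then show ?thesis by (simp add: \<tau>_def h_def)
  qed
  have "complex_embedding F' \<tau>"
  proof
    show "1 \<in> F'" using poly_over_1 by (force simp: F'_def)
    show "\<tau> 1 = 1" using \<tau>[OF poly_over_const[OF one_closed]] by (simp add: hom_poly_const hom_one)
    fix x assume "x \<in> F'"
    then obtain g where g: "poly_over g" "x = poly g z" by (auto simp: F'_def)
    show "inverse x \<in> F'"
    proof (cases "x = 0")
      case True then show ?thesis using \<open>x \<in> F'\<close> by simp
    next
      case False
      then obtain h where "poly_over h" "poly h z * x = 1" using min_poly_inverse[OF m g(1)] g by auto
      moreover from this have "inverse x = poly h z" by (metis inverse_unique mult.commute)
      ultimately show ?thesis by (auto simp: F'_def)
    qed
    fix y assume "y \<in> F'"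
    then obtain h where h: "poly_over h" "y = poly h z" by (auto simp: F'_def)
    have eqs: "x - y = poly (g - h) z" "x * y = poly (g * h) z" "x + y = poly (g + h) z" by (simp_all add: g h)
    note over = poly_over_diff[OF g(1) h(1)] poly_over_mult[OF g(1) h(1)] poly_over_add[OF g(1) h(1)]
    show "x - y \<in> F'" "x * y \<in> F'" using over unfolding eqs F'_def by blast+
    show "\<tau> (x + y) = \<tau> x + \<tau> y" "\<tau> (x * y) = \<tau> x * \<tau> y"
      unfolding eqs \<tau>[OF over(2)] \<tau>[OF over(3)] unfolding g(2) h(2) \<tau>[OF g(1)] \<tau>[OF h(1)]
      by (simp_all add: hom_poly_add hom_poly_mult g(1) h(1))
  qed
  moreover have "x \<in> F'" "\<tau> x = \<sigma> x" if "x \<in> F" for x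
    using \<tau>[OF poly_over_const[OF that]] poly_over_const[OF that]
    by (auto simp: F'_def hom_poly_const intro!: exI[of _ "[:x:]"])
  moreover have zp: "poly_over [:0, 1:]" by (simp add: poly_over_pCons poly_over_const zero_closed one_closed)
  moreover have "z \<in> F'" using zp by (force simp: F'_def)
  moreover have "\<tau> z = z'" using \<tau>[OF zp] by (simp add: map_poly_pCons hom_zero hom_one)
  ultimately show ?thesis by blast
qed

lemma extend_algebraic:
  assumes "p \<noteq> 0" "poly (map_poly of_rat p) z = 0"
  shows "\<exists>F' \<tau>. complex_embedding F' \<tau> \<and> insert z F \<subseteq> F' \<and> (\<forall>x\<in>F. \<tau> x = \<sigma> x)"
proof -
  have "map_poly of_rat p \<noteq> (0 :: complex poly)" using assms(1) by (simp add: map_poly_eq_0_iff)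
  then obtain m where m: "min_poly_of z m" using min_poly_exists[OF poly_over_of_rat _ assms(2)] by blast
  then have m': "poly_over m" "m \<noteq> 0" "poly m z = 0" by (auto simp: min_poly_of_def)
  have "degree m \<noteq> 0" using m' by (metis degree_eq_zeroE mult_zero_right pCons_0_0 poly_0 poly_pCons add_0_right)
  \<comment> \<open>Injectivity of \<sigma> keeps the leading coefficient nonzero, so the image
    polynomial is nonconstant and has a complex root.\<close>
  moreover have "degree (hom_poly m) = degree m"
    using m' by (intro map_poly_degree_eq) (auto simp: hom_eq_0_iff poly_over_def)
  ultimately obtain z' where "poly (hom_poly m) z' = 0" using alg_closed_imp_poly_has_root[of "hom_poly m"] by auto
  from extend[OF m this] show ?thesis by blast
qed

lemma extend_finite:
  assumes "finite A" "\<forall>z\<in>A. \<exists>p. p \<noteq> 0 \<and> poly (map_poly of_rat p) z = 0"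
  shows "\<exists>F' \<tau>. complex_embedding F' \<tau> \<and> A \<union> F \<subseteq> F' \<and> (\<forall>x\<in>F. \<tau> x = \<sigma> x)"
  using assms
proof (induction A)
  case empty
  then show ?case using complex_embedding_axioms by auto
next
  case (insert z A)
  then obtain F' \<tau> where F': "complex_embedding F' \<tau>" "A \<union> F \<subseteq> F'" "\<forall>x\<in>F. \<tau> x = \<sigma> x" by auto
  obtain p where "p \<noteq> 0" "poly (map_poly of_rat p) z = 0" using insert.prems by auto
  from complex_embedding.extend_algebraic[OF F'(1) this] obtain F'' \<upsilon> where
    "complex_embedding F'' \<upsilon>" "insert z F' \<subseteq> F''" "\<forall>x\<in>F'. \<upsilon> x = \<tau> x" by blast
  then show ?case using F' by (intro exI[of _ F''] exI[of _ \<upsilon>]) auto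
qed

end

subsection \<open>The Galois group of a rational polynomial\<close>

lemma a_inv_type_algebra: "a_inv (ring_of_type_algebra :: complex ring) x = - x"
proof -
  interpret field "ring_of_type_algebra :: complex ring" by rule
  show ?thesis by (rule minus_equality) (auto simp: ring_of_type_algebra_def)
qed

lemma m_inv_type_algebra:
  assumes "x \<noteq> 0" shows "m_inv (ring_of_type_algebra :: complex ring) x = inverse x"
proof -
  interpret field "ring_of_type_algebra :: complex ring" by rule
  show ?thesis by (rule comm_inv_char) (auto simp: ring_of_type_algebra_def assms)
qed

abbreviation splitting_carrier :: "rat poly \<Rightarrow> complex set" where
  "splitting_carrier p \<equiv> generate_field ring_of_type_algebra (\<rat> \<union> complex_roots p)"

lemma splitting_field_simps:
  "carrier (splitting_field p) = splitting_carrier p"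
  "x \<otimes>\<^bsub>splitting_field p\<^esub> y = x * y" "x \<oplus>\<^bsub>splitting_field p\<^esub> y = x + y"
  "\<one>\<^bsub>splitting_field p\<^esub> = 1" "\<zero>\<^bsub>splitting_field p\<^esub> = 0"
  by (simp_all add: splitting_field_def ring_of_type_algebra_def)

lemma roots_in_splitting: "z \<in> complex_roots p \<Longrightarrow> z \<in> splitting_carrier p"
  by (auto intro: generate_field.incl)

lemma splitting_closed:
  "1 \<in> splitting_carrier p"
  "x \<in> splitting_carrier p \<Longrightarrow> y \<in> splitting_carrier p \<Longrightarrow> x + y \<in> splitting_carrier p"
  "x \<in> splitting_carrier p \<Longrightarrow> - x \<in> splitting_carrier p"
  "x \<in> splitting_carrier p \<Longrightarrow> y \<in> splitting_carrier p \<Longrightarrow> x * y \<in> splitting_carrier p"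
  "x \<in> splitting_carrier p \<Longrightarrow> inverse x \<in> splitting_carrier p"
proof -
  let ?R = "ring_of_type_algebra :: complex ring"
  let ?H = "\<rat> \<union> complex_roots p"
  show "1 \<in> splitting_carrier p"
    using generate_field.one[of ?R ?H] by (simp add: ring_of_type_algebra_def)
  show "x \<in> splitting_carrier p \<Longrightarrow> y \<in> splitting_carrier p \<Longrightarrow> x + y \<in> splitting_carrier p"
    using generate_field.eng_add[of x ?R ?H y] by (simp add: ring_of_type_algebra_def)
  show "x \<in> splitting_carrier p \<Longrightarrow> y \<in> splitting_carrier p \<Longrightarrow> x * y \<in> splitting_carrier p"
    using generate_field.eng_mult[of x ?R ?H y] by (simp add: ring_of_type_algebra_def)
  show "x \<in> splitting_carrier p \<Longrightarrow> - x \<in> splitting_carrier p"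
    using generate_field.a_inv[of x ?R ?H] by (simp add: a_inv_type_algebra)
  show "x \<in> splitting_carrier p \<Longrightarrow> inverse x \<in> splitting_carrier p"
    using generate_field.m_inv[of x ?R ?H] m_inv_type_algebra[of x]
    by (cases "x = 0") (auto simp: ring_of_type_algebra_def)
qed

lemma splitting_induct [consumes 1, case_names one base uminus inverse add mult]:
  assumes "x \<in> splitting_carrier p"
    and "P 1" "\<And>h. h \<in> \<rat> \<union> complex_roots p \<Longrightarrow> P h"
    and "\<And>h. h \<in> splitting_carrier p \<Longrightarrow> P h \<Longrightarrow> P (- h)"
    and "\<And>h. h \<in> splitting_carrier p \<Longrightarrow> P h \<Longrightarrow> h \<noteq> 0 \<Longrightarrow> P (inverse h)"
    and "\<And>h k. h \<in> splitting_carrier p \<Longrightarrow> P h \<Longrightarrow> k \<in> splitting_carrier p \<Longrightarrow> P k \<Longrightarrow> P (h + k)"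
    and "\<And>h k. h \<in> splitting_carrier p \<Longrightarrow> P h \<Longrightarrow> k \<in> splitting_carrier p \<Longrightarrow> P k \<Longrightarrow> P (h * k)"
  shows "P x"
  using assms(1)
proof (induction rule: generate_field.induct)
  case one then show ?case using assms(2) by (simp add: ring_of_type_algebra_def)
next
  case (incl h) then show ?case by (rule assms(3))
next
  case (a_inv h) then show ?case using assms(4) by (simp add: a_inv_type_algebra)
next
  case (m_inv h)
  then have "h \<noteq> 0" by (simp add: ring_of_type_algebra_def)
  then show ?case using m_inv assms(5) by (simp add: m_inv_type_algebra)
next
  case (eng_add h k) then show ?case using assms(6)[of h k] by (simp add: ring_of_type_algebra_def)
next
  case (eng_mult h k) then show ?case using assms(7)[of h k] by (simp add: ring_of_type_algebra_def)
qed

lemma splitting_minimal: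
  assumes "complex_embedding F \<sigma>" "complex_roots p \<subseteq> F" shows "splitting_carrier p \<subseteq> F"
proof
  interpret complex_embedding F \<sigma> by fact
  fix x assume "x \<in> splitting_carrier p"
  then show "x \<in> F" using assms(2) Rats_closed
    by (induction rule: splitting_induct)
      (auto intro: one_closed uminus_closed inverse_closed add_closed mult_closed)
qed

lemma complex_embedding_splitting:
  assumes "\<And>x y. x \<in> splitting_carrier p \<Longrightarrow> y \<in> splitting_carrier p \<Longrightarrow> \<sigma> (x + y) = \<sigma> x + \<sigma> y"
    "\<And>x y. x \<in> splitting_carrier p \<Longrightarrow> y \<in> splitting_carrier p \<Longrightarrow> \<sigma> (x * y) = \<sigma> x * \<sigma> y"
    "\<sigma> 1 = 1"
  shows "complex_embedding (splitting_carrier p) \<sigma>"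
proof
  show "x - y \<in> splitting_carrier p" if "x \<in> splitting_carrier p" "y \<in> splitting_carrier p" for x y
    using splitting_closed(2)[OF that(1) splitting_closed(3)[OF that(2)]] by simp
qed (use assms splitting_closed in auto)

text \<open>Injectivity and the fixing of rationals are consequences of the embedding laws, so among
  the requirements on an automorphism only surjectivity has to be stated beside them.\<close>

lemma field_auts_iff:
  "\<sigma> \<in> field_auts p \<longleftrightarrow>
     complex_embedding (splitting_carrier p) \<sigma> \<and> \<sigma> ` splitting_carrier p = splitting_carrier p"
proof
  assume "\<sigma> \<in> field_auts p"
  then have "\<sigma> \<in> ring_hom (splitting_field p) (splitting_field p)"
    "bij_betw \<sigma> (splitting_carrier p) (splitting_carrier p)"
    by (auto simp: field_auts_def ring_iso_def splitting_field_simps)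
  then show "complex_embedding (splitting_carrier p) \<sigma> \<and> \<sigma> ` splitting_carrier p = splitting_carrier p"
    by (auto simp: ring_hom_def splitting_field_simps bij_betw_def intro!: complex_embedding_splitting)
next
  assume *: "complex_embedding (splitting_carrier p) \<sigma> \<and> \<sigma> ` splitting_carrier p = splitting_carrier p"
  then interpret complex_embedding "splitting_carrier p" \<sigma> by simp
  have "\<sigma> \<in> ring_iso (splitting_field p) (splitting_field p)"
    using * hom_inj by (auto simp: ring_iso_def ring_hom_def splitting_field_simps bij_betw_def hom_add hom_mult hom_one)
  then show "\<sigma> \<in> field_auts p" by (simp add: field_auts_def hom_Rats)
qed

lemma finite_complex_roots: "p \<noteq> 0 \<Longrightarrow> finite (complex_roots p)"
  unfolding complex_roots_def by (rule poly_roots_finite) (simp add: map_poly_eq_0_iff)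

lemma (in complex_embedding) maps_root:
  assumes "z \<in> F" "z \<in> complex_roots p" shows "\<sigma> z \<in> complex_roots p"
  using hom_poly_eval(1)[OF poly_over_of_rat assms(1), of p] assms(2)
  by (simp add: complex_roots_def hom_poly_of_rat hom_zero)

lemma (in complex_embedding) permutes_roots:
  assumes "complex_roots p \<subseteq> F" "p \<noteq> 0" shows "bij_betw \<sigma> (complex_roots p) (complex_roots p)"
proof -
  have "\<sigma> ` complex_roots p \<subseteq> complex_roots p" using maps_root assms(1) by blast
  moreover have "inj_on \<sigma> (complex_roots p)" using hom_inj assms(1) inj_on_subset by blast
  ultimately show ?thesis
    unfolding bij_betw_def using endo_inj_surj[OF finite_complex_roots[OF assms(2)]] by blast
qed

text \<open>An embedding defined on all roots of \<open>p\<close> permutes them, the root set being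
  finite. Hence it maps the field they generate into itself, and onto itself because its image is
  again a subfield containing the roots.\<close>

lemma (in complex_embedding) field_autsI:
  assumes "complex_roots p \<subseteq> F" "p \<noteq> 0" shows "\<sigma> \<in> field_auts p"
proof -
  let ?K = "splitting_carrier p"
  have sub: "?K \<subseteq> F" by (rule splitting_minimal[OF complex_embedding_axioms assms(1)])
  then have K: "complex_embedding ?K \<sigma>"
    by (intro complex_embedding_splitting) (use sub in \<open>blast intro: hom_add hom_mult hom_one\<close>)+
  then interpret K: complex_embedding ?K \<sigma> .
  have roots: "\<sigma> ` complex_roots p = complex_roots p"
    using permutes_roots[OF assms] by (simp add: bij_betw_def)
  have "\<sigma> x \<in> ?K" if "x \<in> ?K" for x
    using that
  proof (induction rule: splitting_induct)
    case (base h)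
    then show ?case using roots roots_in_splitting K.Rats_closed by (auto simp: hom_Rats)
  qed (auto simp: K.hom_add K.hom_mult hom_one K.hom_uminus K.hom_inverse intro: splitting_closed)
  then have "\<sigma> ` ?K \<subseteq> ?K" by blast
  \<comment> \<open>The identity map serves only to express that the image is a subfield, so that
    \<open>splitting_minimal\<close> applies to it.\<close>
  moreover have "complex_embedding (\<sigma> ` ?K) id"
  proof
    show "1 \<in> \<sigma> ` ?K" using hom_one K.one_closed by (metis imageI)
    fix x assume "x \<in> \<sigma> ` ?K"
    then obtain u where u: "u \<in> ?K" "x = \<sigma> u" by blast
    show "inverse x \<in> \<sigma> ` ?K" using K.hom_inverse[OF u(1)] K.inverse_closed[OF u(1)] u(2) by (metis imageI)
    fix y assume "y \<in> \<sigma> ` ?K"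
    then obtain v where v: "v \<in> ?K" "y = \<sigma> v" by blast
    show "x - y \<in> \<sigma> ` ?K" using K.hom_diff[OF u(1) v(1)] K.diff_closed[OF u(1) v(1)] u v by (metis imageI)
    show "x * y \<in> \<sigma> ` ?K" using K.hom_mult[OF u(1) v(1)] K.mult_closed[OF u(1) v(1)] u v by (metis imageI)
  qed simp_all
  then have "?K \<subseteq> \<sigma> ` ?K" by (rule splitting_minimal) (use roots roots_in_splitting in blast)
  ultimately show ?thesis using K by (auto simp: field_auts_iff)
qed

definition aut_perm :: "rat poly \<Rightarrow> (complex \<Rightarrow> complex) \<Rightarrow> complex \<Rightarrow> complex" where
  "aut_perm p \<sigma> = (\<lambda>z. if z \<in> complex_roots p then \<sigma> z else z)"

lemma galois_group_eq: "galois_group p = aut_perm p ` field_auts p"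
  by (simp add: galois_group_def aut_perm_def[abs_def])

lemma field_auts_roots:
  assumes "\<sigma> \<in> field_auts p" "p \<noteq> 0" shows "bij_betw \<sigma> (complex_roots p) (complex_roots p)"
  using complex_embedding.permutes_roots[of "splitting_carrier p" \<sigma> p] assms roots_in_splitting
  by (auto simp: field_auts_iff)

lemma aut_perm_permutes:
  assumes "\<sigma> \<in> field_auts p" "p \<noteq> 0" shows "aut_perm p \<sigma> permutes complex_roots p"
proof (rule bij_imp_permutes)
  show "bij_betw (aut_perm p \<sigma>) (complex_roots p) (complex_roots p)"
    using field_auts_roots[OF assms] by (simp add: aut_perm_def cong: bij_betw_cong)
qed (simp add: aut_perm_def)

lemma field_auts_comp:
  assumes "\<sigma> \<in> field_auts p" "\<tau> \<in> field_auts p" shows "\<sigma> \<circ> \<tau> \<in> field_auts p"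
  using ring_iso_set_trans[of \<tau> _ _ \<sigma>] assms by (auto simp: field_auts_def)

lemma field_auts_inv:
  assumes "\<sigma> \<in> field_auts p" shows "inv_into (splitting_carrier p) \<sigma> \<in> field_auts p"
proof -
  interpret field "ring_of_type_algebra :: complex ring" by rule
  have "ring (splitting_field p)"
    unfolding splitting_field_def
    by (rule field.is_ring[OF generate_field_is_field]) (simp add: ring_of_type_algebra_def)
  then have "inv_into (splitting_carrier p) \<sigma> \<in> ring_iso (splitting_field p) (splitting_field p)"
    using ring_iso_set_sym[of "splitting_field p" \<sigma>] assms by (auto simp: field_auts_def splitting_field_simps)
  moreover interpret K: complex_embedding "splitting_carrier p" \<sigma> using assms by (simp add: field_auts_iff)
  have "inv_into (splitting_carrier p) \<sigma> q = q" if "q \<in> \<rat>" for q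
    using that K.Rats_closed K.hom_inj K.hom_Rats by (metis inv_into_f_f subsetD)
  ultimately show ?thesis by (simp add: field_auts_def)
qed

section \<open>Irreducible rational polynomials and transitivity on their roots\<close>

lemma map_poly_of_rat_simps:
  "map_poly of_rat (p + q) = (map_poly of_rat p + map_poly of_rat q :: complex poly)"
  "map_poly of_rat (p * q) = (map_poly of_rat p * map_poly of_rat q :: complex poly)"
  "map_poly of_rat (pCons a p) = (pCons (of_rat a) (map_poly of_rat p) :: complex poly)"
  "map_poly of_rat (smult a p) = (smult (of_rat a) (map_poly of_rat p) :: complex poly)"
  "map_poly of_rat (pderiv p) = (pderiv (map_poly of_rat p) :: complex poly)"
  "degree (map_poly of_rat p :: complex poly) = degree p"
  by (auto simp: poly_eq_iff coeff_map_poly of_rat_add coeff_mult of_rat_sum of_rat_mult coeff_pCons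
      coeff_pderiv degree_map_poly split: nat.split)

text \<open>If \<open>f\<close> did not divide \<open>g\<close>, Bezout over the rationals would
  give a \<open>f\<close> + b \<open>g\<close> = 1, and evaluation at the common root would give 0 =
  1.\<close>

lemma irreducible_dvd_of_common_root:
  fixes f g :: "rat poly"
  assumes f: "irreducible f" and z: "z \<in> complex_roots f" "z \<in> complex_roots g"
  shows "f dvd g"
proof (rule ccontr)
  assume "\<not> f dvd g"
  then have "gcd f g = 1"
    using f by (metis coprime_iff_gcd_eq_1 irreducible_imp_prime_elem_gcd prime_elem_imp_coprime)
  then obtain a b where "a * f + b * g = 1" using bezout_coefficients_fst_snd[of f g] by metis
  then have "map_poly of_rat a * map_poly of_rat f + map_poly of_rat b * map_poly of_rat g = (1 :: complex poly)"
    by (simp flip: map_poly_of_rat_simps)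
  then have "poly (map_poly of_rat a * map_poly of_rat f + map_poly of_rat b * map_poly of_rat g) z = 1"
    by (metis poly_1)
  then show False using z by (simp add: complex_roots_def)
qed

lemma irreducible_simple_root:
  assumes "irreducible f" "poly (map_poly of_rat f) z = (0::complex)"
  shows "poly (pderiv (map_poly of_rat f)) z \<noteq> 0"
proof
  assume "poly (pderiv (map_poly of_rat f)) z = 0"
  then have "f dvd pderiv f"
    using irreducible_dvd_of_common_root[OF assms(1), of z "pderiv f"] assms(2)
    by (simp add: complex_roots_def map_poly_of_rat_simps)
  moreover have d: "degree f \<noteq> 0"
  proof
    assume "degree f = 0"
    then obtain a where "f = [:a:]" by (metis degree_eq_zeroE)
    moreover have "a \<noteq> 0" using assms(1) calculation by (auto simp: irreducible_def)
    ultimately have "is_unit f" by (simp add: is_unit_const_poly_iff dvd_field_iff)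
    then show False using assms(1) by (simp add: irreducible_def)
  qed
  then have "pderiv f \<noteq> 0" by (simp add: pderiv_eq_0_iff)
  ultimately have "degree f \<le> degree (pderiv f)" by (simp add: dvd_imp_degree_le)
  then show False using d by (simp add: degree_pderiv)
qed

text \<open>The polynomial \<open>f\<close> is kept separate from \<open>p\<close> because the
  statement is applied both to \<open>p\<close> itself and to the resolvent, whose roots lie in the
  splitting field of \<open>p\<close>. An embedding with \<open>z\<close> going to \<open>z'\<close>
  is built first, then extended to all roots of \<open>p\<close>.\<close>

lemma field_auts_transitive:
  assumes p: "p \<noteq> 0" and f: "irreducible f" and z: "z \<in> complex_roots f" "z' \<in> complex_roots f"
  shows "\<exists>\<sigma>\<in>field_auts p. \<sigma> z = z'"
proof -
  \<comment> \<open>The identity on the rationals is the bottom of the tower of extensions.\<close>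
  interpret Q: complex_embedding \<rat> id by standard auto
  have f0: "f \<noteq> 0" using f by (auto simp: irreducible_def)
  have "Q.min_poly_of z (map_poly of_rat f)"
    unfolding Q.min_poly_of_def
  proof (intro conjI allI impI)
    show "Q.poly_over (map_poly of_rat f)" by (rule Q.poly_over_of_rat)
    show "map_poly of_rat f \<noteq> (0 :: complex poly)" using f0 by (simp add: map_poly_eq_0_iff)
    show "poly (map_poly of_rat f) z = 0" using z by (simp add: complex_roots_def)
    fix g assume g: "Q.poly_over g \<and> g \<noteq> 0 \<and> poly g z = 0"
    then obtain h where h: "g = map_poly of_rat h" using ratpolyE[of g] by (auto simp: Q.poly_over_def)
    then have "f dvd h" "h \<noteq> 0" using irreducible_dvd_of_common_root[OF f z(1), of h] g
      by (auto simp: complex_roots_def)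
    then show "degree (map_poly of_rat f :: complex poly) \<le> degree g"
      unfolding h map_poly_of_rat_simps by (rule dvd_imp_degree_le)
  qed
  moreover have "poly (map_poly id (map_poly of_rat f)) z' = 0" using z by (simp add: complex_roots_def)
  ultimately obtain F \<tau> where F: "complex_embedding F \<tau>" "z \<in> F" "\<tau> z = z'" using Q.extend by blast
  have "\<forall>x\<in>complex_roots p. \<exists>q. q \<noteq> 0 \<and> poly (map_poly of_rat q) x = 0"
    using p by (auto simp: complex_roots_def)
  from complex_embedding.extend_finite[OF F(1) finite_complex_roots[OF p] this] obtain F' \<upsilon> where
    "complex_embedding F' \<upsilon>" "complex_roots p \<union> F \<subseteq> F'" "\<forall>x\<in>F. \<upsilon> x = \<tau> x" by blast
  then show ?thesis using F complex_embedding.field_autsI[of F' \<upsilon> p] p by auto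
qed

lemma galois_group_transitive:
  assumes p: "irreducible p"
  shows "transitive_perm_group (complex_roots p) (galois_group p)"
proof
  have p0: "p \<noteq> 0" using p by (auto simp: irreducible_def)
  show "g permutes complex_roots p" if "g \<in> galois_group p" for g
    using that aut_perm_permutes[OF _ p0] by (auto simp: galois_group_eq)
  interpret id: complex_embedding UNIV id by standard auto
  have "aut_perm p id = id" by (simp add: aut_perm_def fun_eq_iff)
  then show "id \<in> galois_group p"
    using id.field_autsI[OF _ p0] by (force simp: galois_group_eq)
  show "g \<circ> h \<in> galois_group p" if gh: "g \<in> galois_group p" "h \<in> galois_group p" for g h
  proof -
    obtain \<sigma> \<tau> where st: "\<sigma> \<in> field_auts p" "\<tau> \<in> field_auts p" "g = aut_perm p \<sigma>" "h = aut_perm p \<tau>"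
      using gh unfolding galois_group_eq by (elim imageE) blast
    have "\<tau> z \<in> complex_roots p" if "z \<in> complex_roots p" for z
      using field_auts_roots[OF st(2) p0] that by (auto simp: bij_betw_def)
    then have "aut_perm p (\<sigma> \<circ> \<tau>) = g \<circ> h" by (auto simp: st aut_perm_def)
    then show ?thesis using field_auts_comp[OF st(1,2)] by (force simp: galois_group_eq)
  qed
  show "Hilbert_Choice.inv g \<in> galois_group p" if g: "g \<in> galois_group p" for g
  proof -
    obtain \<sigma> where s: "\<sigma> \<in> field_auts p" "g = aut_perm p \<sigma>" using g unfolding galois_group_eq by (elim imageE)
    interpret K: complex_embedding "splitting_carrier p" \<sigma> using s by (simp add: field_auts_iff)
    have "aut_perm p (inv_into (splitting_carrier p) \<sigma>) \<circ> g = id"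
    proof
      fix z
      have "z \<in> complex_roots p \<Longrightarrow> \<sigma> z \<in> complex_roots p"
        using field_auts_roots[OF s(1) p0] by (rule bij_betwE[THEN bspec])
      then show "(aut_perm p (inv_into (splitting_carrier p) \<sigma>) \<circ> g) z = id z"
        using roots_in_splitting inv_into_f_f[OF K.hom_inj] by (simp add: s aut_perm_def)
    qed
    moreover have "g \<circ> Hilbert_Choice.inv g = id"
      using aut_perm_permutes[OF s(1) p0] unfolding s(2)[symmetric] by (rule permutes_inv_o)
    ultimately have "Hilbert_Choice.inv g = aut_perm p (inv_into (splitting_carrier p) \<sigma>)"
      by (metis comp_assoc comp_id id_comp)
    then show ?thesis using field_auts_inv[OF s(1)] by (simp add: galois_group_eq)
  qed
  show "\<exists>g\<in>galois_group p. g x = y" if xy: "x \<in> complex_roots p" "y \<in> complex_roots p" for x y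
  proof -
    obtain \<sigma> where "\<sigma> \<in> field_auts p" "\<sigma> x = y" using field_auts_transitive[OF p0 p xy] by blast
    then show ?thesis using xy(1) unfolding galois_group_eq
      by (intro bexI[of _ "aut_perm p \<sigma>"]) (simp_all add: aut_perm_def)
  qed
qed

section \<open>Galois groups on two, three and four roots\<close>

lemma cnj_galois:
  assumes "p \<noteq> 0" shows "aut_perm p cnj \<in> galois_group p"
proof -
  interpret complex_embedding UNIV cnj by standard auto
  show ?thesis using field_autsI[OF _ assms] by (simp add: galois_group_eq)
qed

lemma galois_group_symmetric_2:
  assumes p: "irreducible p" and roots: "complex_roots p = {x, cnj x}" and x: "cnj x \<noteq> x"
  shows "galois_group p = symmetric_on (complex_roots p)"
proof -
  interpret transitive_perm_group "complex_roots p" "galois_group p" by (rule galois_group_transitive[OF p])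
  have "p \<noteq> 0" using p by (auto simp: irreducible_def)
  moreover have "aut_perm p cnj = transpose x (cnj x)"
    using x by (auto simp: fun_eq_iff aut_perm_def roots transpose_def)
  ultimately have "transpose x (cnj x) \<in> galois_group p" using cnj_galois by metis
  then show ?thesis by (intro symmetric_of_transpositions) (auto simp: roots transpose_commute)
qed

lemma galois_group_symmetric_3:
  assumes p: "irreducible p" and roots: "complex_roots p = {x, cnj x, y}" and x: "cnj x \<noteq> x" and y: "cnj y = y"
  shows "galois_group p = symmetric_on (complex_roots p)"
proof -
  interpret transitive_perm_group "complex_roots p" "galois_group p" by (rule galois_group_transitive[OF p])
  have "p \<noteq> 0" using p by (auto simp: irreducible_def)
  moreover have "aut_perm p cnj = transpose x (cnj x)"
    using x y by (auto simp: fun_eq_iff aut_perm_def roots transpose_def)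
  ultimately have "transpose x (cnj x) \<in> galois_group p" using cnj_galois by metis
  then show ?thesis using x y by (intro symmetric_3[OF roots]) auto
qed

text \<open>The action on the three pairings maps S_4 onto S_3 with the Klein four-group as kernel,
  so the permutations that move every pairing lie over the two 3-cycles of S_3. There are eight of
  them, namely the 3-cycles of S_4. A pairing is tested through the block containing
  \<open>y1\<close>, the other block being its complement.\<close>

lemma perm_of_4_without_fixed_pairing:
  assumes "distinct [y1, y2, y3, y4]" "{y1, y2, y3, y4} \<subseteq> {x1, x2, x3, x4}" "distinct [x1, x2, x3, x4]"
    and "{y1, y2} \<notin> {{x1, x2}, {x3, x4}}" "{y1, y3} \<notin> {{x1, x3}, {x2, x4}}"
    and "{y1, y4} \<notin> {{x1, x4}, {x2, x3}}"
  shows "(y1, y2, y3, y4) \<in> {(x1, x3, x4, x2), (x1, x4, x2, x3), (x3, x2, x4, x1), (x4, x2, x1, x3),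
      (x2, x4, x3, x1), (x4, x1, x3, x2), (x2, x3, x1, x4), (x3, x1, x2, x4)}"
proof -
  have "y1 \<in> {x1, x2, x3, x4}" "y2 \<in> {x1, x2, x3, x4}" "y3 \<in> {x1, x2, x3, x4}" "y4 \<in> {x1, x2, x3, x4}"
    using assms(2) by auto
  then show ?thesis using assms(1,3-6) by (elim insertE emptyE) (simp_all add: doubleton_eq_iff)
qed

lemma three_cycle_of_no_fixed_pairing:
  assumes g: "g permutes {x1, x2, x3, x4}" and dist: "distinct [x1, x2, x3, x4]"
    and pairs: "{g x1, g x2} \<notin> {{x1, x2}, {x3, x4}}" "{g x1, g x3} \<notin> {{x1, x3}, {x2, x4}}"
      "{g x1, g x4} \<notin> {{x1, x4}, {x2, x3}}"
  shows "\<exists>x y z. {x, y, z} \<subseteq> {x1, x2, x3, x4} \<and> distinct [x, y, z] \<and> g = three_cycle x y z"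
proof -
  have "distinct [g x1, g x2, g x3, g x4]" using permutes_inj[OF g] dist by (simp add: inj_eq)
  moreover have "{g x1, g x2, g x3, g x4} \<subseteq> {x1, x2, x3, x4}" using permutes_image[OF g] by simp
  ultimately have cases: "(g x1, g x2, g x3, g x4) \<in> {(x1, x3, x4, x2), (x1, x4, x2, x3), (x3, x2, x4, x1), (x4, x2, x1, x3),
      (x2, x4, x3, x1), (x4, x1, x3, x2), (x2, x3, x1, x4), (x3, x1, x2, x4)}"
    using dist pairs by (rule perm_of_4_without_fixed_pairing)
  have *: ?thesis if abc: "{a, b, c, d} = {x1, x2, x3, x4}" "distinct [a, b, c, d]"
    "g a = b" "g b = c" "g c = a" "g d = d" for a b c d
  proof -
    have "g z = three_cycle a b c z" for z
      using abc(2-) permutes_not_in[OF g, of z] unfolding abc(1)[symmetric]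
      by (auto simp: three_cycle_def transpose_def)
    then show ?thesis using abc(1,2)
      by (intro exI[of _ a] exI[of _ b] exI[of _ c]) (auto simp: fun_eq_iff)
  qed
  show ?thesis
    using cases
  proof (elim insertE emptyE)
    assume "(g x1, g x2, g x3, g x4) = (x1, x3, x4, x2)"
    then show ?thesis using dist by (intro *[of x2 x3 x4 x1]) auto
  next
    assume "(g x1, g x2, g x3, g x4) = (x1, x4, x2, x3)"
    then show ?thesis using dist by (intro *[of x2 x4 x3 x1]) auto
  next
    assume "(g x1, g x2, g x3, g x4) = (x3, x2, x4, x1)"
    then show ?thesis using dist by (intro *[of x1 x3 x4 x2]) auto
  next
    assume "(g x1, g x2, g x3, g x4) = (x4, x2, x1, x3)"
    then show ?thesis using dist by (intro *[of x1 x4 x3 x2]) auto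
  next
    assume "(g x1, g x2, g x3, g x4) = (x2, x4, x3, x1)"
    then show ?thesis using dist by (intro *[of x1 x2 x4 x3]) auto
  next
    assume "(g x1, g x2, g x3, g x4) = (x4, x1, x3, x2)"
    then show ?thesis using dist by (intro *[of x1 x4 x2 x3]) auto
  next
    assume "(g x1, g x2, g x3, g x4) = (x2, x3, x1, x4)"
    then show ?thesis using dist by (intro *[of x1 x2 x3 x4]) auto
  next
    assume "(g x1, g x2, g x3, g x4) = (x3, x1, x2, x4)"
    then show ?thesis using dist by (intro *[of x1 x3 x2 x4]) auto
  qed
qed

text \<open>The three pairings of the roots correspond to the roots of the cubic resolvent. An
  automorphism moving all three pairings is a 3-cycle on the roots.\<close>
lemma galois_group_alternating_4:
  assumes p: "irreducible p" and roots: "complex_roots p = {x1, x2, x3, x4}"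
    and dist: "distinct [x1, x2, x3, x4]"
    and f: "irreducible f" and froots: "complex_roots f =
      {(x1 + x2 - x3 - x4)\<^sup>2, (x1 + x3 - x2 - x4)\<^sup>2, (x1 + x4 - x2 - x3)\<^sup>2}"
  shows "alternating_on (complex_roots p) \<subseteq> galois_group p"
proof -
  interpret transitive_perm_group "complex_roots p" "galois_group p" by (rule galois_group_transitive[OF p])
  have p0: "p \<noteq> 0" using p by (auto simp: irreducible_def)
  have f0: "f \<noteq> 0" using f by (auto simp: irreducible_def)
  define \<theta> where "\<theta> a b c d = (a + b - c - d)\<^sup>2" for a b c d :: complex
  define t1 t2 t3 where "t1 = \<theta> x1 x2 x3 x4" and "t2 = \<theta> x1 x3 x2 x4" and "t3 = \<theta> x1 x4 x2 x3"
  have diffs: "t1 - t2 = 4 * (x1 - x4) * (x2 - x3)" "t1 - t3 = 4 * (x1 - x3) * (x2 - x4)"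
    "t2 - t3 = 4 * (x1 - x2) * (x3 - x4)"
    by (simp_all add: t1_def t2_def t3_def \<theta>_def power2_eq_square algebra_simps)
  have tdist: "t1 \<noteq> t2" "t1 \<noteq> t3" "t2 \<noteq> t3" using diffs dist by auto
  have fr: "complex_roots f = {t1, t2, t3}" by (simp add: froots t1_def t2_def t3_def \<theta>_def)
  have xK: "x1 \<in> splitting_carrier p" "x2 \<in> splitting_carrier p" "x3 \<in> splitting_carrier p" "x4 \<in> splitting_carrier p"
    by (rule roots_in_splitting, simp add: roots)+
  have emb: "complex_embedding (splitting_carrier p) \<sigma>" if "\<sigma> \<in> field_auts p" for \<sigma>
    using that by (simp add: field_auts_iff)
  have \<theta>: "\<theta> a b c d \<in> splitting_carrier p \<and> \<sigma> (\<theta> a b c d) = \<theta> (\<sigma> a) (\<sigma> b) (\<sigma> c) (\<sigma> d)"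
    if "\<sigma> \<in> field_auts p" "{a, b, c, d} \<subseteq> splitting_carrier p" for \<sigma> a b c d
  proof -
    interpret K: complex_embedding "splitting_carrier p" \<sigma> by (rule emb[OF that(1)])
    show ?thesis using that(2) K.hom_power[of "a + b - c - d" 2]
      by (simp add: \<theta>_def K.add_closed K.diff_closed K.hom_add K.hom_diff)
  qed
  have perm: "\<sigma> ` {t1, t2, t3} \<subseteq> {t1, t2, t3} \<and> inj_on \<sigma> {t1, t2, t3}" if s: "\<sigma> \<in> field_auts p" for \<sigma>
  proof -
    interpret K: complex_embedding "splitting_carrier p" \<sigma> by (rule emb[OF s])
    have "{t1, t2, t3} \<subseteq> splitting_carrier p" using \<theta>[OF s] xK by (simp add: t1_def t2_def t3_def)
    then have "bij_betw \<sigma> {t1, t2, t3} {t1, t2, t3}" using K.permutes_roots[of f] f0 fr by simp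
    then show ?thesis by (auto simp: bij_betw_def)
  qed
  obtain \<sigma> where \<sigma>: "\<sigma> \<in> field_auts p" "\<sigma> t1 = t2" using field_auts_transitive[OF p0 f, of t1 t2] fr by auto
  obtain \<tau> where \<tau>: "\<tau> \<in> field_auts p" "\<tau> t1 = t3" using field_auts_transitive[OF p0 f, of t1 t3] fr by auto
  \<comment> \<open>A transitive group on three points has an element without fixed points: either
    \<sigma> or \<tau> already is one, or they are the transpositions of \<open>t1\<close> with
    \<open>t2\<close> and of \<open>t1\<close> with \<open>t3\<close>, and their product is a
    3-cycle.\<close>
  obtain \<rho> where \<rho>: "\<rho> \<in> field_auts p" "\<rho> t1 \<noteq> t1" "\<rho> t2 \<noteq> t2" "\<rho> t3 \<noteq> t3"
  proof -
    have s: "(\<sigma> t2, \<sigma> t3) = (t1, t3) \<or> (\<sigma> t2, \<sigma> t3) = (t3, t1)"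
      using perm[OF \<sigma>(1)] \<sigma>(2) tdist by (auto simp: inj_on_def)
    have t: "(\<tau> t2, \<tau> t3) = (t2, t1) \<or> (\<tau> t2, \<tau> t3) = (t1, t2)"
      using perm[OF \<tau>(1)] \<tau>(2) tdist by (auto simp: inj_on_def)
    show ?thesis
      using s
    proof
      assume s1: "(\<sigma> t2, \<sigma> t3) = (t1, t3)"
      show ?thesis
        using t
      proof
        assume "(\<tau> t2, \<tau> t3) = (t2, t1)"
        then show ?thesis using that[OF field_auts_comp[OF \<tau>(1) \<sigma>(1)]] s1 \<sigma>(2) \<tau>(2) tdist by simp
      next
        assume "(\<tau> t2, \<tau> t3) = (t1, t2)"
        then show ?thesis using that[OF \<tau>(1)] \<tau>(2) tdist by simp
      qed
    next
      assume "(\<sigma> t2, \<sigma> t3) = (t3, t1)"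
      then show ?thesis using that[OF \<sigma>(1)] \<sigma>(2) tdist by simp
    qed
  qed
  define g where "g = aut_perm p \<rho>"
  have g: "g \<in> galois_group p" using \<rho>(1) by (simp add: g_def galois_group_eq)
  have gx: "g x1 = \<rho> x1" "g x2 = \<rho> x2" "g x3 = \<rho> x3" "g x4 = \<rho> x4"
    by (simp_all add: g_def aut_perm_def roots)
  have \<rho>t: "\<rho> t1 = \<theta> (g x1) (g x2) (g x3) (g x4)" "\<rho> t2 = \<theta> (g x1) (g x3) (g x2) (g x4)"
    "\<rho> t3 = \<theta> (g x1) (g x4) (g x2) (g x3)"
    using \<theta>[OF \<rho>(1)] xK by (simp_all add: t1_def t2_def t3_def gx)
  have bij_g: "bij_betw g {x1, x2, x3, x4} {x1, x2, x3, x4}"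
    using permutes[OF g] roots by (simp add: permutes_imp_bij)
  have sums: "g x1 + g x2 + g x3 + g x4 = x1 + x2 + x3 + x4"
  proof -
    have "(\<Sum>x\<in>{x1, x2, x3, x4}. g x) = (\<Sum>x\<in>{x1, x2, x3, x4}. x)"
      using sum.reindex_bij_betw[OF bij_g, of "\<lambda>x. x"] by simp
    then show ?thesis using dist by (simp add: add.assoc)
  qed
  \<comment> \<open>With the total sum fixed, \<theta> depends only on the pairing: exchanging the
    two blocks changes the sign inside the square.\<close>
  have \<theta>_cong: "\<theta> a b c d = \<theta> a' b' c' d'"
    if "a + b + c + d = a' + b' + c' + d'" "a + b = a' + b' \<or> a + b = c' + d'" for a b c d a' b' c' d'
  proof -
    have "(u - v)\<^sup>2 = (u' - v')\<^sup>2" if "u + v = u' + v'" "u = u' \<or> u = v'" for u v u' v' :: complex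
      using that(2)
    proof
      assume "u = u'" then show ?thesis using that(1) by simp
    next
      assume "u = v'"
      then have "v = u'" using that(1) by (metis add.commute add_left_cancel)
      then show ?thesis using \<open>u = v'\<close> by (simp add: power2_commute)
    qed
    from this[of "a + b" "c + d" "a' + b'" "c' + d'"] show ?thesis
      using that unfolding \<theta>_def diff_diff_eq add.assoc by blast
  qed
  have pairing: "{a, b} \<notin> {{a', b'}, {c', d'}}" if "\<theta> a b c d \<noteq> \<theta> a' b' c' d'"
    "a + b + c + d = a' + b' + c' + d'" for a b c d a' b' c' d'
  proof
    assume "{a, b} \<in> {{a', b'}, {c', d'}}"
    then have "a + b = a' + b' \<or> a + b = c' + d'" by (simp add: doubleton_eq_iff) (metis add.commute)
    then show False using \<theta>_cong[OF that(2)] that(1) by blast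
  qed
  have "{g x1, g x2} \<notin> {{x1, x2}, {x3, x4}}"
    using \<rho>(2) unfolding \<rho>t unfolding t1_def by (rule pairing) (rule sums)
  moreover have "{g x1, g x3} \<notin> {{x1, x3}, {x2, x4}}"
  proof (rule pairing)
    show "\<theta> (g x1) (g x3) (g x2) (g x4) \<noteq> \<theta> x1 x3 x2 x4" using \<rho>(3) unfolding \<rho>t unfolding t2_def .
    show "g x1 + g x3 + g x2 + g x4 = x1 + x3 + x2 + x4" using sums by (simp only: ac_simps)
  qed
  moreover have "{g x1, g x4} \<notin> {{x1, x4}, {x2, x3}}"
  proof (rule pairing)
    show "\<theta> (g x1) (g x4) (g x2) (g x3) \<noteq> \<theta> x1 x4 x2 x3" using \<rho>(4) unfolding \<rho>t unfolding t3_def .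
    show "g x1 + g x4 + g x2 + g x3 = x1 + x4 + x2 + x3" using sums by (simp only: ac_simps)
  qed
  ultimately have "\<exists>x y z. {x, y, z} \<subseteq> {x1, x2, x3, x4} \<and> distinct [x, y, z] \<and> g = three_cycle x y z"
    by (rule three_cycle_of_no_fixed_pairing[OF permutes[OF g, unfolded roots] dist])
  then obtain x y z where xyz: "{x, y, z} \<subseteq> complex_roots p" "distinct [x, y, z]" "g = three_cycle x y z"
    unfolding roots by blast
  show ?thesis by (rule alternating_4[OF roots dist g[unfolded xyz(3)] xyz(1,2)])
qed

subsection \<open>Irreducibility criteria and the shifted Laguerre polynomials\<close>

lemma gen_laguerre_2:
  "gen_laguerre 2 (- 2 - c) = smult (1 / 2) (pcompose [:c, 0, 1:] [:c, 1:])"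
  by (simp add: gen_laguerre_def numeral_eq_Suc gbinomial_Suc fact_Suc pcompose_pCons, simp add: field_simps)

lemma gen_laguerre_3:
  "gen_laguerre 3 (- 3 - c) = smult (1 / 6) (pcompose [:2 * c, 3 * c, 0, 1:] [:c, 1:])"
  by (simp add: gen_laguerre_def numeral_eq_Suc gbinomial_Suc fact_Suc pcompose_pCons, simp add: field_simps)

lemma gen_laguerre_4:
  "gen_laguerre 4 (- 4 - c) = smult (1 / 24) (pcompose [:3 * c\<^sup>2 + 6 * c, 8 * c, 6 * c, 0, 1:] [:c, 1:])"
  by (simp add: gen_laguerre_def numeral_eq_Suc gbinomial_Suc fact_Suc pcompose_pCons, simp add: field_simps)

text \<open>Upper negation turns the binomial with top -(r + 1) into an ordinary one with sign
  (-1)^(n - j); together with (-1)^n and (-1)^j all signs cancel.\<close>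

lemma laguerre_r_eq:
  "laguerre_r n r = (\<Sum>j\<le>n. Polynomial.monom (of_nat ((n - j + r) choose (n - j)) / fact j) j)"
proof -
  have "smult ((-1) ^ n) (smult (((of_nat n + (- 1 - of_nat n - of_nat r)) gchoose (n - j)) / fact j) ([:0, -1:] ^ j))
      = Polynomial.monom (of_nat ((n - j + r) choose (n - j)) / fact j :: rat) j" if "j \<le> n" for j
  proof -
    have 1: "of_nat n + (- 1 - of_nat n - of_nat r) = (- (of_nat r + 1) :: rat)" by simp
    have 2: "(- (of_nat r + 1) :: rat) gchoose (n - j) = (- 1) ^ (n - j) * of_nat ((n - j + r) choose (n - j))"
      by (subst gbinomial_minus) (simp add: binomial_gbinomial add.commute)
    have 3: "[:0, -1:] ^ j = (Polynomial.monom ((-1) ^ j) j :: rat poly)"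
      by (induction j) (simp_all add: monom_Suc monom_0 minus_monom)
    have "(-1 :: rat) ^ n * ((-1) ^ (n - j) * (-1) ^ j) = 1"
      using that by (simp flip: power_add)
    then show ?thesis unfolding 1 2 3 smult_monom by simp
  qed
  moreover have "smult k (sum f A) = (\<Sum>j\<in>A. smult k (f j))" for k :: rat and f :: "nat \<Rightarrow> rat poly" and A
    by (induction A rule: infinite_finite_induct) (simp_all add: smult_add_right)
  ultimately show ?thesis unfolding laguerre_r_def gen_laguerre_def by simp
qed

lemma irreducible_not_unit_degree: "irreducible (p :: rat poly) \<Longrightarrow> p \<noteq> 0 \<and> degree p > 0"
  using is_unit_iff_degree[of p] by (auto simp: irreducible_def)

lemma irreducible_by_degree:
  fixes p :: "rat poly"
  assumes "degree p > 0" and fac: "\<And>a b. p = a * b \<Longrightarrow> 0 < degree a \<Longrightarrow> degree a \<le> degree b \<Longrightarrow> False"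
  shows "irreducible p"
proof (rule irreducibleI)
  show p0: "p \<noteq> 0" using assms(1) by auto
  then show "\<not> is_unit p" using assms(1) by (simp add: is_unit_iff_degree)
  fix a b assume ab: "p = a * b"
  then have "a \<noteq> 0" "b \<noteq> 0" using p0 by auto
  then show "is_unit a \<or> is_unit b"
    using fac[OF ab] fac[of b a] ab by (simp add: is_unit_iff_degree mult.commute) (metis gr0I nat_le_linear)
qed

lemma irreducible_shift:
  fixes q :: "rat poly"
  assumes q: "irreducible q" and k: "k \<noteq> 0"
  shows "irreducible (smult k (pcompose q [:c, 1:]))"
proof (rule irreducible_by_degree)
  show "0 < degree (smult k (pcompose q [:c, 1:]))"
    using irreducible_not_unit_degree[OF q] k by (simp add: degree_pcompose)
  fix a b assume ab: "smult k (pcompose q [:c, 1:]) = a * b" and deg: "0 < degree a" "degree a \<le> degree b"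
  have "q = pcompose (smult (1 / k) (smult k (pcompose q [:c, 1:]))) [:- c, 1:]"
    using k by (simp flip: pcompose_assoc add: pcompose_pCons)
  then have "q = smult (1 / k) (pcompose a [:- c, 1:]) * pcompose b [:- c, 1:]"
    unfolding ab by (simp add: pcompose_smult pcompose_mult)
  then have "is_unit (smult (1 / k) (pcompose a [:- c, 1:])) \<or> is_unit (pcompose b [:- c, 1:])"
    using q by (auto simp: irreducible_def)
  moreover have "degree r = 0" if "is_unit r" for r :: "rat poly" using that by (auto simp: is_unit_poly_iff)
  moreover have "degree (smult (1 / k) (pcompose a [:- c, 1:])) = degree a" "degree (pcompose b [:- c, 1:]) = degree b"
    using k by (simp_all add: degree_pcompose)
  ultimately have "degree a = 0 \<or> degree b = 0" by metis
  then show False using deg by auto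
qed

lemma irreducible_shift_iff:
  fixes q :: "rat poly"
  assumes k: "k \<noteq> 0"
  shows "irreducible (smult k (pcompose q [:c, 1:])) \<longleftrightarrow> irreducible q"
proof
  assume "irreducible (smult k (pcompose q [:c, 1:]))"
  from irreducible_shift[OF this, of "1 / k" "- c"] show "irreducible q"
    using k by (simp add: pcompose_smult flip: pcompose_assoc) (simp add: pcompose_pCons)
qed (rule irreducible_shift[OF _ k])

lemma complex_roots_shift:
  assumes "k \<noteq> 0"
  shows "complex_roots (smult k (pcompose q [:c, 1:])) = (\<lambda>y. y - of_rat c) ` complex_roots q"
proof -
  have "map_poly of_rat (pcompose q [:c, 1:]) = pcompose (map_poly of_rat q) [:of_rat c, 1::complex:]"
    by (induction q) (simp_all add: map_poly_of_rat_simps pcompose_pCons)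
  then have "z \<in> complex_roots (smult k (pcompose q [:c, 1:])) \<longleftrightarrow> z + of_rat c \<in> complex_roots q" for z
    using assms by (simp add: complex_roots_def map_poly_of_rat_simps poly_pcompose add.commute)
  then show ?thesis by (force simp: image_iff diff_eq_eq)
qed

lemma root_of_linear_factor:
  fixes p :: "rat poly"
  assumes "p = a * b" "degree a = 1" shows "\<exists>x. poly p x = 0"
proof -
  obtain u v where "a = [:u, v:]" "v \<noteq> 0" using assms(2) by (metis degree1_coeffs)
  then have "poly p (- u / v) = 0" using assms(1) by simp
  then show ?thesis by blast
qed

lemma irreducible_of_no_root:
  fixes p :: "rat poly"
  assumes "degree p \<in> {2, 3}" "\<And>x. poly p x \<noteq> 0"
  shows "irreducible p"
proof (rule irreducible_by_degree)
  show "0 < degree p" using assms(1) by auto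
  fix a b assume ab: "p = a * b" and deg: "0 < degree a" "degree a \<le> degree b"
  moreover have "degree p = degree a + degree b" using ab assms(1) by (cases "a = 0 \<or> b = 0") (auto simp: degree_mult_eq)
  ultimately have "degree a = 1" using assms(1) by auto
  then show False using root_of_linear_factor[OF ab] assms(2) by blast
qed

section \<open>The shifted quartic and its factorization into quadratics\<close>

definition quartic :: "'a :: comm_ring_1 \<Rightarrow> 'a poly" where
  "quartic c = [:3 * c\<^sup>2 + 6 * c, 8 * c, 6 * c, 0, 1:]"

text \<open>The hypotheses compare coefficients in \<open>quartic c\<close> = (y^2 + a y + b) (y^2 -
  a y + d); b and d are eliminated through (b + d)^2 - (d - b)^2 = 4 b d. The type is general
  because the identity is used over the rationals and over the complex numbers.\<close>

lemma quartic_factor_resolvent: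
  fixes c :: "'a :: idom"
  assumes "b + d - a\<^sup>2 = 6 * c" "a * (d - b) = 8 * c" "b * d = 3 * c\<^sup>2 + 6 * c"
  shows "(a\<^sup>2)^3 + 12 * c * (a\<^sup>2)\<^sup>2 + 24 * c * (c - 1) * a\<^sup>2 - 64 * c\<^sup>2 = 0"
proof -
  have bd: "b + d = 6 * c + a\<^sup>2" using assms(1) by (simp add: algebra_simps)
  have "a\<^sup>2 * (b + d)\<^sup>2 - (a * (d - b))\<^sup>2 = 4 * a\<^sup>2 * (b * d)"
    by (simp add: power2_eq_square algebra_simps)
  then have "a\<^sup>2 * (6 * c + a\<^sup>2)\<^sup>2 - (8 * c)\<^sup>2 = 4 * a\<^sup>2 * (3 * c\<^sup>2 + 6 * c)"
    unfolding bd assms(2,3) .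
  then show ?thesis by (simp add: power2_eq_square power3_eq_cube algebra_simps)
qed

lemma irreducible_quartic:
  fixes c :: rat
  assumes c: "c > 0" and res: "\<And>a. (a\<^sup>2)^3 + 12 * c * (a\<^sup>2)\<^sup>2 + 24 * c * (c - 1) * a\<^sup>2 - 64 * c\<^sup>2 \<noteq> 0"
  shows "irreducible (quartic c)"
proof (rule irreducible_by_degree)
  show "0 < degree (quartic c)" by (simp add: quartic_def)
  fix p q assume pq: "quartic c = p * q" and deg: "0 < degree p" "degree p \<le> degree q"
  have pos: "poly (quartic c) y > 0" for y
  proof -
    \<comment> \<open>The square is completed in 6 c y^2 + 8 c y + 6 c.\<close>
    have "poly (quartic c) y = (y\<^sup>2)\<^sup>2 + 3 * c\<^sup>2 + 2 * c * ((3 * y + 2)\<^sup>2 + 5) / 3"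
      by (simp add: quartic_def power2_eq_square algebra_simps)
    moreover have "3 * c\<^sup>2 > 0" "2 * c * ((3 * y + 2)\<^sup>2 + 5) / 3 \<ge> 0" using c by simp_all
    moreover have "(y\<^sup>2)\<^sup>2 \<ge> 0" by simp
    ultimately show ?thesis by linarith
  qed
  have "degree p \<noteq> 1"
  proof
    assume "degree p = 1"
    then obtain y where "poly (quartic c) y = 0" using root_of_linear_factor[OF pq] by blast
    then show False using pos[of y] by simp
  qed
  moreover have "degree (quartic c) = 4" by (simp add: quartic_def)
  then have "degree p + degree q = 4"
    using degree_mult_eq[of p q] unfolding pq by (cases "p = 0 \<or> q = 0") auto
  ultimately have "degree p = 2" "degree q = 2" using deg by auto
  then obtain p0 p1 p2 q0 q1 q2 where p: "p = [:p0, p1, p2:]" and q: "q = [:q0, q1, q2:]"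
    by (elim degree2_coeffs) simp
  have "quartic c = [:p0 * q0, p0 * q1 + p1 * q0, p0 * q2 + p1 * q1 + p2 * q0, p1 * q2 + p2 * q1, p2 * q2:]"
    using pq by (simp add: p q add_ac)
  then have eqs: "p2 * q2 = 1" "p1 * q2 + p2 * q1 = 0" "p0 * q2 + p1 * q1 + p2 * q0 = 6 * c"
    "p0 * q1 + p1 * q0 = 8 * c" "p0 * q0 = 3 * c\<^sup>2 + 6 * c"
    by (simp_all add: quartic_def)
  \<comment> \<open>Since \<open>p2 * q2 = 1\<close>, multiplying \<open>p\<close> by
    \<open>q2\<close> and \<open>q\<close> by \<open>p2\<close> makes them the monic factors y^2 + a
    y + b and y^2 - a y + d.\<close>
  define a b d where "a = p1 * q2" and "b = p0 * q2" and "d = p2 * q0"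
  have a': "p2 * q1 = - a" using eqs(2) by (simp add: a_def eq_neg_iff_add_eq_0 add.commute)
  have scale: "x * y = (x * q2) * (p2 * y)" for x y
  proof -
    have "(x * q2) * (p2 * y) = (x * y) * (p2 * q2)" by (simp add: mult_ac)
    then show ?thesis using eqs(1) by simp
  qed
  have 1: "b + d - a\<^sup>2 = 6 * c" using eqs(3) scale[of p1 q1] unfolding a'
    by (simp add: a_def b_def d_def power2_eq_square)
  have "p0 * q1 = b * (p2 * q1)" "p1 * q0 = a * d" "p0 * q0 = b * d"
    unfolding a_def b_def d_def by (rule scale)+
  then have 2: "a * (d - b) = 8 * c" and 3: "b * d = 3 * c\<^sup>2 + 6 * c"
    using eqs(4,5) a' by (simp_all add: algebra_simps)
  show False using quartic_factor_resolvent[OF 1 2 3] res by blast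
qed

text \<open>The elimination is reversible when a is nonzero: b + d = 6 c + a^2 and d - b = 8 c / a
  determine b and d, and the resolvent equation is exactly the remaining condition on b d.\<close>

lemma reducible_quartic:
  fixes c a :: rat
  assumes a: "a \<noteq> 0" and res: "(a\<^sup>2)^3 + 12 * c * (a\<^sup>2)\<^sup>2 + 24 * c * (c - 1) * a\<^sup>2 - 64 * c\<^sup>2 = 0"
  shows "\<not> irreducible (quartic c)"
proof
  assume irr: "irreducible (quartic c)"
  define s e where "s = 6 * c + a\<^sup>2" and "e = 8 * c / a"
  define b d where "b = (s - e) / 2" and "d = (s + e) / 2"
  have ae: "a * e = 8 * c" using a by (simp add: e_def)
  have "4 * (b * d) = s\<^sup>2 - e\<^sup>2" by (simp add: b_def d_def power2_eq_square algebra_simps)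
  then have "a\<^sup>2 * (4 * (b * d)) = a\<^sup>2 * s\<^sup>2 - (a * e)\<^sup>2" by (simp only: power_mult_distrib right_diff_distrib)
  also have "\<dots> = a\<^sup>2 * (4 * (3 * c\<^sup>2 + 6 * c))"
    using res unfolding ae s_def by (simp add: power2_eq_square power3_eq_cube algebra_simps)
  finally have bd: "b * d = 3 * c\<^sup>2 + 6 * c" using a by simp
  have "b + d = s" "d - b = e" by (simp_all add: b_def d_def field_simps)
  then have "b + d - a * a = 6 * c" "a * d - a * b = 8 * c"
    using ae by (simp_all add: s_def power2_eq_square flip: right_diff_distrib)
  moreover have "[:b, a, 1:] * [:d, - a, 1:] = [:b * d, a * d - a * b, b + d - a * a, 0, 1:]" by simp
  ultimately have "quartic c = [:b, a, 1:] * [:d, - a, 1:]" using bd by (simp add: quartic_def)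
  then have "is_unit [:b, a, 1:] \<or> is_unit [:d, - a, 1:]" using irr by (auto simp: irreducible_def)
  then show False by (simp add: is_unit_iff_degree)
qed

text \<open>The roots come as a list so that expanding the product gives Vieta's relations. A
  repeated entry would be a common root with the derivative, which irreducibility forbids.\<close>

lemma monic_irreducible_split:
  assumes irr: "irreducible p" and lc: "lead_coeff p = 1" and deg: "degree p = n"
  shows "\<exists>xs. length xs = n \<and> distinct xs \<and> complex_roots p = set xs \<and>
    map_poly of_rat p = (\<Prod>x\<leftarrow>xs. [:- x, 1:])"
proof -
  let ?P = "map_poly of_rat p :: complex poly"
  have "?P \<noteq> 0" using irr by (auto simp: irreducible_def map_poly_eq_0_iff)
  moreover have lc': "lead_coeff ?P = 1"
    by (simp add: map_poly_of_rat_simps coeff_map_poly lc)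
  ultimately obtain A where A: "size A = degree ?P" "?P = (\<Prod>x\<in>#A. [:- x, 1:])"
    using alg_closed_imp_factorization[of ?P] by auto
  obtain xs where xs: "A = mset xs" by (metis ex_mset)
  have P: "?P = (\<Prod>x\<leftarrow>xs. [:- x, 1:])" unfolding A(2) xs by (metis mset_map prod_mset_prod_list)
  have "distinct xs"
  proof (rule ccontr)
    assume "\<not> distinct xs"
    then obtain as x bs cs where "xs = as @ [x] @ bs @ [x] @ cs" by (metis not_distinct_decomp)
    then have "?P = [:- x, 1:] * ([:- x, 1:] * (\<Prod>x\<leftarrow>as @ bs @ cs. [:- x, 1:]))"
      unfolding P by (simp add: mult_ac del: mult_pCons_left mult_pCons_right)
    then obtain h where h: "?P = [:- x, 1:] * ([:- x, 1:] * h)" by blast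
    have "poly (pderiv ?P) x = 0" "poly ?P x = 0"
      unfolding h by (simp_all add: pderiv_mult del: mult_pCons_left mult_pCons_right)
    then show False using irreducible_simple_root[OF irr, of x] by blast
  qed
  moreover have "poly (\<Prod>x\<leftarrow>ys. [:- x, 1:]) z = 0 \<longleftrightarrow> z \<in> set ys" for ys and z :: complex
    by (induction ys) auto
  then have "complex_roots p = set xs" unfolding complex_roots_def P by auto
  moreover have "length xs = n" using A(1) by (simp add: xs map_poly_of_rat_simps deg)
  ultimately show ?thesis using P by blast
qed

lemma cnj_complex_roots: "z \<in> complex_roots p \<Longrightarrow> cnj z \<in> complex_roots p"
proof -
  interpret complex_embedding UNIV cnj by standard auto
  show "z \<in> complex_roots p \<Longrightarrow> cnj z \<in> complex_roots p" using maps_root by simp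
qed

lemma cnj_of_rat: "cnj (of_rat q) = of_rat q"
proof -
  interpret complex_embedding UNIV cnj by standard auto
  show ?thesis by (rule hom_of_rat)
qed

lemma of_rat_Reals: "of_rat q = complex_of_real (of_rat q)"
proof -
  obtain a b where "quotient_of q = (a, b)" by (cases "quotient_of q")
  then have "q = of_int a / of_int b" by (rule quotient_of_div)
  then show ?thesis by (simp add: of_rat_divide)
qed

section \<open>Galois groups of the shifted quadratic and cubic\<close>

lemma quadratic_symmetric:
  fixes c k s :: rat
  assumes c: "c > 0" and k: "k \<noteq> 0"
  defines "p \<equiv> smult k (pcompose [:c, 0, 1:] [:s, 1:])"
  shows "irreducible p \<and> galois_group p = symmetric_on (complex_roots p)"
proof -
  have "poly [:c, 0, 1:] x \<noteq> 0" for x using c by simp (metis add_pos_nonneg less_irrefl zero_le_square)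
  then have irr: "irreducible [:c, 0, 1:]" by (intro irreducible_of_no_root) auto
  then have p: "irreducible p" unfolding p_def by (rule irreducible_shift[OF _ k])
  from monic_irreducible_split[OF irr, of 2] obtain xs where
    xs: "length xs = 2" "complex_roots [:c, 0, 1:] = set xs"
      "map_poly of_rat [:c, 0, 1:] = (\<Prod>x\<leftarrow>xs. [:- x, 1:])" by fastforce
  then obtain y z where yz: "xs = [y, z]" by (auto simp: length_Suc_conv numeral_eq_Suc)
  have "y + z = 0" "of_rat c = y * z"
    using xs(3) by (auto simp: yz map_poly_of_rat_simps)
  moreover from this have z: "z = - y" by (simp add: eq_neg_iff_add_eq_0 add.commute)
  ultimately have y2: "y\<^sup>2 = - of_rat c" by (simp add: power2_eq_square)
  have y: "cnj y \<noteq> y"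
  proof
    assume "cnj y = y"
    then obtain u where "y = of_real u" by (metis Reals_cnj_iff Reals_cases)
    then have "complex_of_real (u\<^sup>2) = complex_of_real (- of_rat c)"
      using y2 by (simp add: of_rat_Reals)
    then have "u\<^sup>2 = - of_rat c" unfolding of_real_eq_iff .
    then show False using c zero_le_power2[of u] by (simp add: not_less[symmetric])
  qed
  have "cnj y \<in> {y, z}" using cnj_complex_roots[of y] xs yz by auto
  then have "complex_roots [:c, 0, 1:] = {y, cnj y}" using xs y by (auto simp: yz)
  then have roots: "complex_roots p = {y - of_rat s, cnj (y - of_rat s)}"
    unfolding p_def by (simp add: complex_roots_shift[OF k] cnj_of_rat)
  show ?thesis using p galois_group_symmetric_2[OF p roots] y by (simp add: cnj_of_rat)
qed

text \<open>The roots have sum 0 and second symmetric function c, so their squares sum to -2 c < 0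
  and they cannot all be real. Conjugation swaps two roots and must fix the third.\<close>

lemma cubic_symmetric:
  fixes b c k s :: rat
  assumes irr: "irreducible [:b, c, 0, 1:]" and c: "c > 0" and k: "k \<noteq> 0"
  defines "p \<equiv> smult k (pcompose [:b, c, 0, 1:] [:s, 1:])"
  shows "irreducible p \<and> galois_group p = symmetric_on (complex_roots p)"
proof -
  have p: "irreducible p" unfolding p_def by (rule irreducible_shift[OF irr k])
  let ?R = "complex_roots [:b, c, 0, 1:]"
  from monic_irreducible_split[OF irr, of 3] obtain xs where
    xs: "length xs = 3" "distinct xs" "?R = set xs"
      "map_poly of_rat [:b, c, 0, 1:] = (\<Prod>x\<leftarrow>xs. [:- x, 1:])" by fastforce
  then obtain y1 y2 y3 where y: "xs = [y1, y2, y3]" by (auto simp: length_Suc_conv numeral_eq_Suc)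
  have e: "y1 + y2 + y3 = 0" "y1 * y2 + y1 * y3 + y2 * y3 = of_rat c"
    using xs(4) by (simp_all add: y map_poly_of_rat_simps algebra_simps eq_neg_iff_add_eq_0)
  have "\<exists>y\<in>?R. cnj y \<noteq> y"
  proof (rule ccontr)
    assume "\<not> ?thesis"
    then have "y1 \<in> \<real>" "y2 \<in> \<real>" "y3 \<in> \<real>" using xs(3) by (auto simp: y Reals_cnj_iff)
    then obtain u1 u2 u3 where u: "y1 = of_real u1" "y2 = of_real u2" "y3 = of_real u3" by (metis Reals_cases)
    have "complex_of_real (u1 + u2 + u3) = complex_of_real 0"
      "complex_of_real (u1 * u2 + u1 * u3 + u2 * u3) = complex_of_real (of_rat c)"
      using e by (simp_all add: u of_rat_Reals)
    then have "u1 + u2 + u3 = 0" "u1 * u2 + u1 * u3 + u2 * u3 = of_rat c" unfolding of_real_eq_iff by auto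
    moreover have "(u1 + u2 + u3)\<^sup>2 = u1\<^sup>2 + u2\<^sup>2 + u3\<^sup>2 + 2 * (u1 * u2 + u1 * u3 + u2 * u3)"
      by (simp add: power2_eq_square algebra_simps)
    ultimately have "u1\<^sup>2 + u2\<^sup>2 + u3\<^sup>2 + 2 * of_rat c = 0" by simp
    moreover have "(of_rat c :: real) > 0" using c by simp
    ultimately show False using zero_le_power2[of u1] zero_le_power2[of u2] zero_le_power2[of u3] by linarith
  qed
  then obtain y where yR: "y \<in> ?R" "cnj y \<noteq> y" by blast
  have card: "card ?R = 3" "finite ?R" using xs by (simp_all add: distinct_card)
  then have "card (?R - {y, cnj y}) = 1"
    using yR cnj_complex_roots[OF yR(1)] by (subst card_Diff_subset) auto
  then obtain t where t: "?R - {y, cnj y} = {t}" by (auto simp: card_1_singleton_iff)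
  then have R: "?R = {y, cnj y, t}" and tn: "t \<noteq> y" "t \<noteq> cnj y" using yR cnj_complex_roots[OF yR(1)] by auto
  have "cnj t \<in> {y, cnj y, t}" using cnj_complex_roots[of t] R by blast
  then have "cnj t = t" using tn by (auto simp: complex_cnj_cancel_iff)
  then show ?thesis using p yR galois_group_symmetric_3[OF p, of "y - of_rat s" "t - of_rat s"]
    by (simp add: p_def complex_roots_shift[OF k] cnj_of_rat R)
qed

section \<open>The cubic resolvent and the Galois group of the quartic\<close>

definition resolvent :: "'a :: comm_ring_1 \<Rightarrow> 'a poly" where
  "resolvent c = [:- 4096 * c\<^sup>2, 384 * c * (c - 1), 48 * c, 1:]"

text \<open>The variable of \<open>resolvent\<close> is 16 w, the square (x1 + x2 - x3 - x4)^2
  itself. This scaling makes the cubic monic, with integer coefficients for integral c, whereas the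
  equation for w has leading coefficient 2.\<close>

lemma poly_resolvent: "poly (resolvent c) (16 * w) = 2048 * (2 * w^3 + 6 * c * w\<^sup>2 + 3 * c * (c - 1) * w - 2 * c\<^sup>2)"
  by (simp add: resolvent_def power2_eq_square power3_eq_cube algebra_simps)

lemma of_rat_quartic: "map_poly of_rat (quartic c) = quartic (of_rat c :: complex)"
  and of_rat_resolvent: "map_poly of_rat (resolvent c) = resolvent (of_rat c :: complex)"
  by (simp_all add: quartic_def resolvent_def map_poly_of_rat_simps of_rat_add of_rat_mult of_rat_power
      of_rat_minus of_rat_diff)

text \<open>Each pairing of the roots gives a factorization into quadratics with a = - (z1 + z2),
  hence a resolvent root 4 a^2. Differences of the three values are 4 times products of root
  differences, so the values are distinct and exhaust the roots of a cubic.\<close>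

lemma quartic_roots:
  assumes irr: "irreducible (quartic c)"
  obtains y1 y2 y3 y4 where "distinct [y1, y2, y3, y4]" "complex_roots (quartic c) = {y1, y2, y3, y4}"
    "complex_roots (resolvent c) =
      {(y1 + y2 - y3 - y4)\<^sup>2, (y1 + y3 - y2 - y4)\<^sup>2, (y1 + y4 - y2 - y3)\<^sup>2}"
proof -
  let ?c = "of_rat c :: complex"
  have "lead_coeff (quartic c) = 1" "degree (quartic c) = 4" by (simp_all add: quartic_def)
  from monic_irreducible_split[OF irr this] obtain xs where
    xs: "length xs = 4" "distinct xs" "complex_roots (quartic c) = set xs"
      "map_poly of_rat (quartic c) = (\<Prod>x\<leftarrow>xs. [:- x, 1:])" by blast
  then obtain y1 y2 y3 y4 where y: "xs = [y1, y2, y3, y4]" by (auto simp: length_Suc_conv numeral_eq_Suc)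
  have "(\<Prod>x\<leftarrow>xs. [:- x, 1:]) = [:y1 * y2 * y3 * y4,
      - (y1 * y2 * y3 + y1 * y2 * y4 + y1 * y3 * y4 + y2 * y3 * y4),
      y1 * y2 + y1 * y3 + y1 * y4 + y2 * y3 + y2 * y4 + y3 * y4, - (y1 + y2 + y3 + y4), 1:]"
    by (simp add: y algebra_simps)
  then have "quartic ?c = [:y1 * y2 * y3 * y4,
      - (y1 * y2 * y3 + y1 * y2 * y4 + y1 * y3 * y4 + y2 * y3 * y4),
      y1 * y2 + y1 * y3 + y1 * y4 + y2 * y3 + y2 * y4 + y3 * y4, - (y1 + y2 + y3 + y4), 1:]"
    using xs(4) by (simp only: of_rat_quartic)
  note coeffs = this[unfolded quartic_def pCons_eq_iff]
  have e': "0 = - (y1 + y2 + y3 + y4)"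
    "6 * ?c = y1 * y2 + y1 * y3 + y1 * y4 + y2 * y3 + y2 * y4 + y3 * y4"
    "8 * ?c = - (y1 * y2 * y3 + y1 * y2 * y4 + y1 * y3 * y4 + y2 * y3 * y4)"
    "3 * ?c\<^sup>2 + 6 * ?c = y1 * y2 * y3 * y4"
    using coeffs by blast+
  have "y1 + y2 + y3 + y4 = 0" using e'(1)[symmetric] unfolding neg_equal_0_iff_equal .
  note e = this e'(2-)[symmetric]
  have root: "(z1 + z2 - z3 - z4)\<^sup>2 \<in> complex_roots (resolvent c)"
    if z: "z1 + z2 + z3 + z4 = 0"
      "z1 * z2 + z1 * z3 + z1 * z4 + z2 * z3 + z2 * z4 + z3 * z4 = 6 * ?c"
      "- (z1 * z2 * z3 + z1 * z2 * z4 + z1 * z3 * z4 + z2 * z3 * z4) = 8 * ?c"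
      "z1 * z2 * z3 * z4 = 3 * ?c\<^sup>2 + 6 * ?c" for z1 z2 z3 z4
  proof -
    define a where "a = - (z1 + z2)"
    have a: "z1 + z2 = - a" "z3 + z4 = a" using z(1) by (auto simp: a_def eq_neg_iff_add_eq_0 algebra_simps)
    have "z1 * z2 + z3 * z4 + (z1 + z2) * (z3 + z4) = 6 * ?c" using z(2) by (simp add: algebra_simps)
    then have 1: "z1 * z2 + z3 * z4 - a\<^sup>2 = 6 * ?c" unfolding a by (simp add: power2_eq_square)
    have "- (z1 * z2 * (z3 + z4) + z3 * z4 * (z1 + z2)) = 8 * ?c" using z(3) by (simp add: algebra_simps)
    then have 2: "a * (z3 * z4 - z1 * z2) = 8 * ?c" unfolding a by (simp add: algebra_simps)
    have 3: "(z1 * z2) * (z3 * z4) = 3 * ?c\<^sup>2 + 6 * ?c" using z(4) by (simp add: mult_ac)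
    have "z1 + z2 - z3 - z4 = - (2 * a)" using a by (simp add: diff_diff_eq)
    then have t: "(z1 + z2 - z3 - z4)\<^sup>2 = 16 * (a\<^sup>2 / 4)" by (simp add: power2_eq_square)
    have "poly (resolvent ?c) (16 * (a\<^sup>2 / 4)) = 64 * ((a\<^sup>2)^3 + 12 * ?c * (a\<^sup>2)\<^sup>2 + 24 * ?c * (?c - 1) * a\<^sup>2 - 64 * ?c\<^sup>2)"
      unfolding poly_resolvent by (simp add: field_simps)
    also have "\<dots> = 0" unfolding quartic_factor_resolvent[OF 1 2 3] by simp
    finally show ?thesis by (simp add: complex_roots_def of_rat_resolvent t)
  qed
  let ?T = "{(y1 + y2 - y3 - y4)\<^sup>2, (y1 + y3 - y2 - y4)\<^sup>2, (y1 + y4 - y2 - y3)\<^sup>2}"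
  have sub: "?T \<subseteq> complex_roots (resolvent c)"
    using root[of y1 y2 y3 y4] root[of y1 y3 y2 y4] root[of y1 y4 y2 y3] e by (simp add: ac_simps)
  have dist: "distinct [y1, y2, y3, y4]" using xs(2) y by simp
  have "(y1 + y2 - y3 - y4)\<^sup>2 - (y1 + y3 - y2 - y4)\<^sup>2 = 4 * (y1 - y4) * (y2 - y3)"
    "(y1 + y2 - y3 - y4)\<^sup>2 - (y1 + y4 - y2 - y3)\<^sup>2 = 4 * (y1 - y3) * (y2 - y4)"
    "(y1 + y3 - y2 - y4)\<^sup>2 - (y1 + y4 - y2 - y3)\<^sup>2 = 4 * (y1 - y2) * (y3 - y4)"
    by (simp_all add: power2_eq_square algebra_simps)
  then have "card ?T = 3" using dist by (auto simp: card_insert_if)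
  moreover have r0: "resolvent c \<noteq> 0" "degree (resolvent c) = 3" by (simp_all add: resolvent_def)
  then have "card (complex_roots (resolvent c)) \<le> 3"
    using card_poly_roots_bound[of "map_poly of_rat (resolvent c) :: complex poly"]
    by (simp add: complex_roots_def map_poly_eq_0_iff map_poly_of_rat_simps)
  ultimately have "complex_roots (resolvent c) = ?T"
    using sub finite_complex_roots[OF r0(1)] by (metis card_seteq)
  then show ?thesis using that[OF dist] xs(3) y by simp
qed

lemma quartic_alternating:
  fixes c k s :: rat
  assumes irr: "irreducible (quartic c)" and res: "irreducible (resolvent c)" and k: "k \<noteq> 0"
  defines "p \<equiv> smult k (pcompose (quartic c) [:s, 1:])"
  shows "alternating_on (complex_roots p) \<subseteq> galois_group p"
proof -
  obtain y1 y2 y3 y4 where y: "distinct [y1, y2, y3, y4]" "complex_roots (quartic c) = {y1, y2, y3, y4}"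
    "complex_roots (resolvent c) = {(y1 + y2 - y3 - y4)\<^sup>2, (y1 + y3 - y2 - y4)\<^sup>2, (y1 + y4 - y2 - y3)\<^sup>2}"
    by (rule quartic_roots[OF irr])
  have p: "irreducible p" unfolding p_def by (rule irreducible_shift[OF irr k])
  show ?thesis
  proof (rule galois_group_alternating_4[OF p])
    show "complex_roots p = {y1 - of_rat s, y2 - of_rat s, y3 - of_rat s, y4 - of_rat s}"
      by (simp add: p_def complex_roots_shift[OF k] y)
    show "distinct [y1 - of_rat s, y2 - of_rat s, y3 - of_rat s, y4 - of_rat s]" using y by simp
  qed (use y res in \<open>simp_all add: algebra_simps\<close>)
qed

text \<open>A 3-cycle does not fix any of the three pairings of the roots, so it moves each root of the
  resolvent; an automorphism fixes the rational ones.\<close>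
lemma not_alternating_of_rational_pairing:
  assumes p: "irreducible p" and roots: "complex_roots p = {x1, x2, x3, x4}"
    and dist: "distinct [x1, x2, x3, x4]" and rat: "(x1 + x2 - x3 - x4)\<^sup>2 \<in> \<rat>"
  shows "\<not> alternating_on (complex_roots p) \<subseteq> galois_group p"
proof
  assume "alternating_on (complex_roots p) \<subseteq> galois_group p"
  moreover have "three_cycle x1 x2 x3 \<in> alternating_on (complex_roots p)"
    using dist by (auto simp: alternating_on_def roots intro!: three_cycle_permutes evenperm_three_cycle)
  ultimately obtain \<sigma> where \<sigma>: "\<sigma> \<in> field_auts p" "three_cycle x1 x2 x3 = aut_perm p \<sigma>"
    unfolding galois_group_eq by blast
  have "aut_perm p \<sigma> x = \<sigma> x" if "x \<in> complex_roots p" for x using that by (simp add: aut_perm_def)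
  then have "\<sigma> x = three_cycle x1 x2 x3 x" if "x \<in> complex_roots p" for x using that \<sigma>(2) by simp
  moreover have "three_cycle x1 x2 x3 x4 = x4" using dist by (intro three_cycle_apply(4)) auto
  ultimately have s: "\<sigma> x1 = x2" "\<sigma> x2 = x3" "\<sigma> x3 = x1" "\<sigma> x4 = x4"
    using dist by (simp_all add: roots three_cycle_apply)
  interpret complex_embedding "splitting_carrier p" \<sigma> using \<sigma> by (simp add: field_auts_iff)
  have xK: "x1 \<in> splitting_carrier p" "x2 \<in> splitting_carrier p" "x3 \<in> splitting_carrier p" "x4 \<in> splitting_carrier p"
    by (rule roots_in_splitting, simp add: roots)+
  have "\<sigma> ((x1 + x2 - x3 - x4)\<^sup>2) = (x2 + x3 - x1 - x4)\<^sup>2"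
    using hom_power[of "x1 + x2 - x3 - x4" 2] xK by (simp add: add_closed diff_closed hom_add hom_diff s)
  then have "(x1 + x2 - x3 - x4)\<^sup>2 - (x2 + x3 - x1 - x4)\<^sup>2 = 0" using hom_Rats[OF rat] by simp
  moreover have "(x1 + x2 - x3 - x4)\<^sup>2 - (x2 + x3 - x1 - x4)\<^sup>2 = 4 * (x1 - x3) * (x2 - x4)"
    by (simp add: power2_eq_square algebra_simps)
  ultimately show False using dist by simp
qed

lemma quartic_not_alternating:
  fixes c k s :: rat
  assumes irr: "irreducible (quartic c)" and w: "poly (resolvent c) w = 0" and k: "k \<noteq> 0"
  defines "p \<equiv> smult k (pcompose (quartic c) [:s, 1:])"
  shows "\<not> alternating_on (complex_roots p) \<subseteq> galois_group p"
proof -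
  obtain y1 y2 y3 y4 where y: "distinct [y1, y2, y3, y4]" "complex_roots (quartic c) = {y1, y2, y3, y4}"
    "complex_roots (resolvent c) = {(y1 + y2 - y3 - y4)\<^sup>2, (y1 + y3 - y2 - y4)\<^sup>2, (y1 + y4 - y2 - y3)\<^sup>2}"
    by (rule quartic_roots[OF irr])
  interpret complex_embedding \<rat> id by standard auto
  have p: "irreducible p" unfolding p_def by (rule irreducible_shift[OF irr k])
  let ?s = "of_rat s"
  have "poly (map_poly of_rat (resolvent c)) (of_rat w) = (of_rat (poly (resolvent c) w) :: complex)"
    by (simp add: resolvent_def map_poly_of_rat_simps of_rat_add of_rat_mult of_rat_diff of_rat_minus of_rat_power)
  then have w': "of_rat w \<in> complex_roots (resolvent c)" using w by (simp add: complex_roots_def)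
  \<comment> \<open>The rational value may belong to any of the three pairings; relabelling the
    roots brings it to the first.\<close>
  have *: ?thesis if "(z1 + z2 - z3 - z4)\<^sup>2 = of_rat w" "complex_roots (quartic c) = {z1, z2, z3, z4}"
    "distinct [z1, z2, z3, z4]" for z1 z2 z3 z4
  proof (rule not_alternating_of_rational_pairing[OF p])
    show "complex_roots p = {z1 - ?s, z2 - ?s, z3 - ?s, z4 - ?s}"
      by (simp add: p_def complex_roots_shift[OF k] that)
    show "distinct [z1 - ?s, z2 - ?s, z3 - ?s, z4 - ?s]" using that by simp
    have "(z1 - ?s) + (z2 - ?s) - (z3 - ?s) - (z4 - ?s) = z1 + z2 - z3 - z4" by simp
    then show "((z1 - ?s) + (z2 - ?s) - (z3 - ?s) - (z4 - ?s))\<^sup>2 \<in> \<rat>" by (simp only: that Rats_of_rat)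
  qed
  have d: "distinct [y1, y3, y2, y4]" "distinct [y1, y4, y2, y3]" using y(1) by auto
  have r: "complex_roots (quartic c) = {y1, y3, y2, y4}" "complex_roots (quartic c) = {y1, y4, y2, y3}"
    unfolding y(2) by blast+
  show ?thesis
    using w' unfolding y(3)
  proof (elim insertE emptyE)
    assume "of_rat w = (y1 + y2 - y3 - y4)\<^sup>2"
    from *[OF this[symmetric] y(2,1)] show ?thesis .
  next
    assume "of_rat w = (y1 + y3 - y2 - y4)\<^sup>2"
    from *[OF this[symmetric] r(1) d(1)] show ?thesis .
  next
    assume "of_rat w = (y1 + y4 - y2 - y3)\<^sup>2"
    from *[OF this[symmetric] r(2) d(2)] show ?thesis .
  qed
qed

subsection \<open>Integral parameters\<close>

lemma rational_root_int:
  fixes x :: rat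
  assumes "lead_coeff p = 1" "\<forall>i. coeff p i \<in> \<int>" "poly p x = 0"
  obtains n :: int where "x = of_int n"
  using rational_algebraic_int_is_int[OF algebraic_int.intros[OF assms]] by (auto simp: Ints_def Rats_def id_def)

lemma infinite_of_unbounded:
  fixes S :: "rat set"
  assumes "\<And>N :: nat. \<exists>x\<in>S. of_nat N \<le> \<bar>x\<bar>"
  shows "infinite S"
proof
  assume "finite S"
  then have fin: "finite (abs ` S)" by simp
  obtain N :: nat where N: "Max (abs ` S) < of_nat N" using reals_Archimedean2 by blast
  obtain x where "x \<in> S" "of_nat N \<le> \<bar>x\<bar>" using assms by blast
  then show False using N Max_ge[OF fin, of "\<bar>x\<bar>"] by simp
qed

lemma irreducible_depressed_cubic:
  fixes C :: int
  assumes "C \<ge> 1" shows "irreducible [:2 * of_int C, 3 * of_int C, 0, 1 :: rat:]"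
proof (rule irreducible_of_no_root)
  fix x :: rat
  show "poly [:2 * of_int C, 3 * of_int C, 0, 1:] x \<noteq> 0"
  proof
    assume root: "poly [:2 * of_int C, 3 * of_int C, 0, 1:] x = 0"
    then obtain y where y: "x = of_int y"
      by (rule rational_root_int[rotated 2]) (auto simp: coeff_pCons split: nat.split)
    have "of_int (2 * C + 3 * C * y + y^3) = (0 :: rat)"
      using root by (simp add: y power3_eq_cube algebra_simps)
    then have eq: "2 * C + 3 * C * y + y^3 = 0" by (simp only: of_int_eq_0_iff)
    show False
    proof (cases "y \<ge> 0")
      case True
      then have "3 * C * y \<ge> 0" "y^3 \<ge> 0" using assms by simp_all
      then show False using eq assms by linarith
    next
      case False
      then have "C * y \<le> C * (- 1)" using assms by (intro mult_left_mono) auto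
      moreover have "y^3 < 0" using False by (simp add: power_less_zero_eq)
      ultimately show False using eq assms by linarith
    qed
  qed
qed simp

lemma irreducible_quartic_int:
  fixes C :: int
  assumes C: "C \<ge> 1" shows "irreducible (quartic (of_int C :: rat))"
proof (rule irreducible_quartic)
  show "0 < (of_int C :: rat)" using C by simp
  fix a :: rat
  let ?c = "of_int C :: rat"
  show "(a\<^sup>2)^3 + 12 * ?c * (a\<^sup>2)\<^sup>2 + 24 * ?c * (?c - 1) * a\<^sup>2 - 64 * ?c\<^sup>2 \<noteq> 0"
  proof
    assume res: "(a\<^sup>2)^3 + 12 * ?c * (a\<^sup>2)\<^sup>2 + 24 * ?c * (?c - 1) * a\<^sup>2 - 64 * ?c\<^sup>2 = 0"
    then have "poly [:- 64 * ?c\<^sup>2, 0, 24 * ?c * (?c - 1), 0, 12 * ?c, 0, 1:] a = 0"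
      by (simp add: power2_eq_square power3_eq_cube algebra_simps)
    then obtain n where n: "a = of_int n"
      by (rule rational_root_int[rotated 2]) (auto simp: coeff_pCons split: nat.split)
    define u where "u = n\<^sup>2"
    have "of_int (u^3 + 12 * C * u\<^sup>2 + 24 * (C * (C - 1)) * u - 64 * C\<^sup>2) = (0 :: rat)"
      using res by (simp add: n u_def mult.assoc)
    then have eq: "u^3 + 12 * C * u\<^sup>2 + 24 * (C * (C - 1)) * u - 64 * C\<^sup>2 = 0" by (simp only: of_int_eq_0_iff)
    consider "n = 0" | "\<bar>n\<bar> = 1" | "\<bar>n\<bar> \<ge> 2" by linarith
    then show False
    proof cases
      case 1
      then show False using eq C by (simp add: u_def)
    next
      case 2
      moreover have "u = \<bar>n\<bar>\<^sup>2" by (simp add: u_def)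
      ultimately have "u = 1" by simp
      then have "1 = 40 * (C * C) + 12 * C" using eq by (simp add: power2_eq_square algebra_simps)
      moreover have "C * C \<ge> 0" by simp
      ultimately show False using C by linarith
    next
      \<comment> \<open>From \<open>u\<close> at least 4 and \<open>C\<close> at least 1, the left
        side of \<open>eq\<close> is at least 32 C^2 + 96 C, hence positive.\<close>
      case 3
      then have "2\<^sup>2 \<le> \<bar>n\<bar>\<^sup>2" by (intro power_mono) auto
      then have u: "u \<ge> 4" unfolding u_def by simp
      then have "4\<^sup>2 \<le> u\<^sup>2" by (intro power_mono) auto
      then have "12 * C * u\<^sup>2 \<ge> 12 * C * 16" using C by (intro mult_left_mono) auto
      moreover have "24 * (C * (C - 1)) * u \<ge> 24 * (C * (C - 1)) * 4" using C u by (intro mult_left_mono) auto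
      moreover have "u^3 \<ge> 0" "C\<^sup>2 \<ge> 0" using u by simp_all
      moreover have "C * (C - 1) = C\<^sup>2 - C" by (simp add: power2_eq_square algebra_simps)
      ultimately show False using eq C by linarith
    qed
  qed
qed

text \<open>A root \<open>w = - k\<close> makes the equation quadratic in \<open>C\<close> with a square discriminant,
  which forces \<open>k\<close> to divide \<open>4 * C\<close>; the quotient \<open>L\<close> satisfies an equation without integer
  solutions.\<close>
lemma resolvent_no_int_root:
  fixes C w :: int
  assumes C: "C \<ge> 1" shows "2 * w^3 + 6 * C * w\<^sup>2 + 3 * C * (C - 1) * w - 2 * C\<^sup>2 \<noteq> 0"
proof
  assume eq: "2 * w^3 + 6 * C * w\<^sup>2 + 3 * C * (C - 1) * w - 2 * C\<^sup>2 = 0"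
  consider "w = 0" | "w \<ge> 1" | "w \<le> - 1" by linarith
  then show False
  proof cases
    case 1
    then show False using eq C by simp
  next
    case 2
    have "3 * C * (C - 1) * w \<ge> 3 * C * (C - 1) * 1" using C 2 by (intro mult_left_mono) auto
    moreover have "1\<^sup>2 \<le> w\<^sup>2" using 2 by (intro power_mono) auto
    then have "6 * C * w\<^sup>2 \<ge> 6 * C * 1" using C by (intro mult_left_mono) auto
    moreover have "w^3 \<ge> 0" "C\<^sup>2 \<ge> 0" using 2 by simp_all
    moreover have "3 * C * (C - 1) * 1 = 3 * C\<^sup>2 - 3 * C" by (simp add: power2_eq_square algebra_simps)
    ultimately show False using eq C by linarith
  next
    case 3
    define k where "k = - w"
    have k: "k \<ge> 1" "w = - k" using 3 by (auto simp: k_def)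
    have eq': "(3 * k + 2) * C\<^sup>2 - (6 * k\<^sup>2 + 3 * k) * C + 2 * k^3 = 0"
      using eq unfolding k(2) by (simp add: power2_eq_square power3_eq_cube algebra_simps)
    have "(2 * (3 * k + 2) * C - (6 * k\<^sup>2 + 3 * k))\<^sup>2 =
      4 * (3 * k + 2) * ((3 * k + 2) * C\<^sup>2 - (6 * k\<^sup>2 + 3 * k) * C + 2 * k^3) + k\<^sup>2 * (12 * k\<^sup>2 + 20 * k + 9)"
      by (simp add: power2_eq_square power3_eq_cube algebra_simps)
    then have "k\<^sup>2 dvd (2 * (3 * k + 2) * C - (6 * k\<^sup>2 + 3 * k))\<^sup>2" unfolding eq' by simp
    then have "k dvd 2 * (3 * k + 2) * C - (6 * k\<^sup>2 + 3 * k)" by (simp add: pow_divides_pow_iff)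
    moreover have "2 * (3 * k + 2) * C - (6 * k\<^sup>2 + 3 * k) = 4 * C + k * (6 * C - 6 * k - 3)"
      by (simp add: power2_eq_square algebra_simps)
    ultimately have "k dvd 4 * C" by (simp add: dvd_add_left_iff)
    then obtain L where L: "4 * C = k * L" by (elim dvdE)
    have "k\<^sup>2 * ((3 * k + 2) * L\<^sup>2 - 4 * (6 * k + 3) * L + 32 * k) =
      (3 * k + 2) * (k * L)\<^sup>2 - 4 * (6 * k\<^sup>2 + 3 * k) * (k * L) + 32 * k^3"
      by (simp add: power2_eq_square power3_eq_cube algebra_simps)
    also have "\<dots> = 16 * ((3 * k + 2) * C\<^sup>2 - (6 * k\<^sup>2 + 3 * k) * C + 2 * k^3)"
      unfolding L[symmetric] by (simp add: power2_eq_square algebra_simps)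
    finally have "(3 * k + 2) * L\<^sup>2 - 4 * (6 * k + 3) * L + 32 * k = 0" using eq' k by simp
    then have final: "k * (3 * L\<^sup>2 - 24 * L + 32) + 2 * (L * (L - 6)) = 0"
      by (simp add: power2_eq_square algebra_simps)
    \<comment> \<open>For L outside 1..6 both summands of \<open>final\<close> are nonnegative and
      the first is positive. For L = 1 the left side is 11 k - 10, and for L = 2, ..., 6 it is
      negative.\<close>
    consider "L \<le> 0" | "L \<in> {1, 2, 3, 4, 5, 6}" | "L \<ge> 7" by fastforce
    then show False
    proof cases
      case 1
      then have "L * (L - 6) \<ge> 0" by (intro mult_nonpos_nonpos) auto
      moreover have "3 * L\<^sup>2 - 24 * L + 32 > 0" using 1 zero_le_power2[of L] by linarith
      then have "k * (3 * L\<^sup>2 - 24 * L + 32) > 0" using k by (intro mult_pos_pos) auto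
      ultimately show False using final by linarith
    next
      case 2
      then show False using final k by (elim insertE emptyE) simp_all
    next
      case 3
      then have "L * (L - 6) \<ge> 0" by (intro mult_nonneg_nonneg) auto
      moreover have "3 * L\<^sup>2 - 24 * L + 32 = 3 * ((L - 7) * (L - 1)) + 11" by (simp add: power2_eq_square algebra_simps)
      moreover have "(L - 7) * (L - 1) \<ge> 0" using 3 by (intro mult_nonneg_nonneg) auto
      ultimately have "k * (3 * L\<^sup>2 - 24 * L + 32) > 0" using k by (intro mult_pos_pos) auto
      then show False using final \<open>L * (L - 6) \<ge> 0\<close> by linarith
    qed
  qed
qed

text \<open>A rational root is an integer t. The equation shows t^3 to be even, and this persists
  through four halvings, so w = t / 16 is an integer root of the unscaled equation.\<close>

lemma irreducible_resolvent_int: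
  fixes C :: int
  assumes C: "C \<ge> 1" shows "irreducible (resolvent (of_int C :: rat))"
proof (rule irreducible_of_no_root)
  show "degree (resolvent (of_int C :: rat)) \<in> {2, 3}" by (simp add: resolvent_def)
  fix x :: rat
  show "poly (resolvent (of_int C)) x \<noteq> 0"
  proof
    assume root: "poly (resolvent (of_int C)) x = 0"
    then obtain t where t: "x = of_int t"
      by (rule rational_root_int[rotated 2]) (auto simp: resolvent_def coeff_pCons split: nat.split)
    have "of_int (t^3 + 48 * C * t\<^sup>2 + 384 * C * (C - 1) * t - 4096 * C\<^sup>2) = (0 :: rat)"
      using root by (simp add: t resolvent_def power2_eq_square power3_eq_cube algebra_simps)
    then have eq: "t^3 + 48 * C * t\<^sup>2 + 384 * C * (C - 1) * t - 4096 * C\<^sup>2 = 0" by (simp only: of_int_eq_0_iff)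
    have even3: "even s" if "s^3 = 2 * r" for s r :: int using that by (metis dvd_triv_left even_power)
    have "t^3 = 2 * (2048 * C\<^sup>2 - 24 * C * t\<^sup>2 - 192 * C * (C - 1) * t)" using eq by (simp add: algebra_simps)
    then obtain t1 where t1: "t = 2 * t1" using even3 by blast
    have eq1: "t1^3 + 24 * C * t1\<^sup>2 + 96 * C * (C - 1) * t1 - 512 * C\<^sup>2 = 0"
      using eq unfolding t1 by (simp add: power_mult_distrib)
    then have "t1^3 = 2 * (256 * C\<^sup>2 - 12 * C * t1\<^sup>2 - 48 * C * (C - 1) * t1)" by (simp add: algebra_simps)
    then obtain t2 where t2: "t1 = 2 * t2" using even3 by blast
    have eq2: "t2^3 + 12 * C * t2\<^sup>2 + 24 * C * (C - 1) * t2 - 64 * C\<^sup>2 = 0"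
      using eq1 unfolding t2 by (simp add: power_mult_distrib)
    then have "t2^3 = 2 * (32 * C\<^sup>2 - 6 * C * t2\<^sup>2 - 12 * C * (C - 1) * t2)" by (simp add: algebra_simps)
    then obtain t3 where t3: "t2 = 2 * t3" using even3 by blast
    have eq3: "t3^3 + 6 * C * t3\<^sup>2 + 6 * C * (C - 1) * t3 - 8 * C\<^sup>2 = 0"
      using eq2 unfolding t3 by (simp add: power_mult_distrib)
    then have "t3^3 = 2 * (4 * C\<^sup>2 - 3 * C * t3\<^sup>2 - 3 * C * (C - 1) * t3)" by (simp add: algebra_simps)
    then obtain w where w: "t3 = 2 * w" using even3 by blast
    have "2 * w^3 + 6 * C * w\<^sup>2 + 3 * C * (C - 1) * w - 2 * C\<^sup>2 = 0"
      using eq3 unfolding w by (simp add: power_mult_distrib)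
    then show False using resolvent_no_int_root[OF C] by blast
  qed
qed

lemma laguerre_r_irreducible_galois:
  fixes n r :: nat
  assumes n: "1 \<le> n" "n \<le> 4"
  defines "p \<equiv> laguerre_r n r"
  shows "irreducible p \<and> alternating_on (complex_roots p) \<subseteq> galois_group p \<and>
    (n \<le> 3 \<longrightarrow> galois_group p = symmetric_on (complex_roots p))"
proof -
  define C :: int where "C = int r + 1"
  define c :: rat where "c = of_int C"
  have C: "C \<ge> 1" and c: "c > 0" by (simp_all add: C_def c_def)
  have p: "p = gen_laguerre n (- of_nat n - c)"
    unfolding p_def laguerre_r_def by (rule arg_cong[of _ _ "gen_laguerre n"]) (simp add: c_def C_def)
  have alt: "alternating_on S \<subseteq> symmetric_on S" for S :: "complex set"
    by (auto simp: alternating_on_def symmetric_on_def)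
  consider "n = 1" | "n = 2" | "n = 3" | "n = 4" using n by linarith
  then show ?thesis
  proof cases
    case 1
    have p1: "p = [:c, 1:]"
      unfolding p_def laguerre_r_eq by (simp add: 1 c_def C_def monom_0 monom_Suc)
    have irr: "irreducible p"
    proof (rule irreducible_by_degree)
      fix a b assume ab: "p = a * b" "0 < degree a" "degree a \<le> degree b"
      then have "a \<noteq> 0" "b \<noteq> 0" by auto
      then have "degree p = degree a + degree b" using ab(1) by (simp add: degree_mult_eq)
      moreover have "degree p = 1" by (simp add: p1)
      ultimately show False using ab by simp
    qed (simp add: p1)
    interpret transitive_perm_group "complex_roots p" "galois_group p" by (rule galois_group_transitive[OF irr])
    \<comment> \<open>With at most one root there are no two distinct points, and the condition on
      transpositions is vacuous.\<close>
    have "complex_roots p \<subseteq> {- of_rat c}"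
      by (auto simp: complex_roots_def p1 map_poly_of_rat_simps eq_neg_iff_add_eq_0 add.commute)
    then have "galois_group p = symmetric_on (complex_roots p)"
      by (intro symmetric_of_transpositions) (auto intro: finite_subset)
    then show ?thesis using irr alt by simp
  next
    case 2
    have "p = smult (1 / 2) (pcompose [:c, 0, 1:] [:c, 1:])" unfolding p 2 using gen_laguerre_2[of c] by simp
    then show ?thesis using quadratic_symmetric[OF c, of "1 / 2" c] alt by simp
  next
    case 3
    have irr: "irreducible [:2 * c, 3 * c, 0, 1:]" unfolding c_def by (rule irreducible_depressed_cubic[OF C])
    have "p = smult (1 / 6) (pcompose [:2 * c, 3 * c, 0, 1:] [:c, 1:])" unfolding p 3 using gen_laguerre_3[of c] by simp
    then show ?thesis using cubic_symmetric[OF irr, of "1 / 6" c] c alt by simp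
  next
    case 4
    have "p = smult (1 / 24) (pcompose (quartic c) [:c, 1:])"
      unfolding p 4 using gen_laguerre_4[of c] by (simp add: quartic_def)
    moreover have "irreducible (quartic c)" "irreducible (resolvent c)"
      unfolding c_def by (rule irreducible_quartic_int[OF C], rule irreducible_resolvent_int[OF C])
    ultimately show ?thesis
      using quartic_alternating[of c "1 / 24" c] irreducible_shift[of "quartic c" "1 / 24" c] 4 by simp
  qed
qed

subsection \<open>Exceptional rational parameters\<close>

text \<open>For c = - t^2 the shifted quadratic is a difference of two squares.\<close>

lemma reducible_gen_laguerre_2: "infinite {\<alpha> :: rat. \<not> irreducible (gen_laguerre 2 \<alpha>)}"
proof (rule infinite_of_unbounded)
  fix N :: nat
  define t :: rat where "t = of_nat N + 2"
  have t: "t \<ge> 2" by (simp add: t_def)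
  have "\<not> irreducible [:- t\<^sup>2, 0, 1:]"
  proof
    assume irr: "irreducible [:- t\<^sup>2, 0, 1:]"
    have "[:- t\<^sup>2, 0, 1:] = [:- t, 1:] * [:t, 1:]" by (simp add: power2_eq_square)
    then have "is_unit [:- t, 1:] \<or> is_unit [:t, 1:]" using irr by (auto simp: irreducible_def)
    then show False by (simp add: is_unit_iff_degree)
  qed
  then have "\<not> irreducible (gen_laguerre 2 (- 2 - - t\<^sup>2))"
    unfolding gen_laguerre_2 by (simp add: irreducible_shift_iff)
  moreover have "t\<^sup>2 \<ge> 2 * t" using mult_right_mono[OF t, of t] t by (simp add: power2_eq_square)
  then have "of_nat N \<le> \<bar>- 2 - - t\<^sup>2\<bar>" by (simp add: t_def)
  ultimately show "\<exists>x\<in>{\<alpha>. \<not> irreducible (gen_laguerre 2 \<alpha>)}. of_nat N \<le> \<bar>x\<bar>" by blast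
qed

text \<open>The condition y^3 + 3 c y + 2 c = 0 is linear in c, so a prescribed rational root y is
  obtained by solving for c.\<close>

lemma reducible_gen_laguerre_3: "infinite {\<alpha> :: rat. \<not> irreducible (gen_laguerre 3 \<alpha>)}"
proof (rule infinite_of_unbounded)
  fix N :: nat
  \<comment> \<open>The estimate y^3 / (3 y + 2) \<ge> y / 5 makes - c at least N + 3, which absorbs
    the shift in \<alpha> = - 3 - c.\<close>
  define y :: rat where "y = 5 * (of_nat N + 3)"
  have y: "y \<ge> 1" "of_nat N + 3 = y / 5" by (simp_all add: y_def)
  define c where "c = - (y^3 / (3 * y + 2))"
  have c: "c * (3 * y + 2) = - (y^3)" using y by (simp add: c_def)
  have "\<not> irreducible [:2 * c, 3 * c, 0, 1:]"
  proof
    assume irr: "irreducible [:2 * c, 3 * c, 0, 1:]"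
    have "2 * c = - (y * (y\<^sup>2 + 3 * c))" using c by (simp add: power2_eq_square power3_eq_cube algebra_simps)
    then have "[:2 * c, 3 * c, 0, 1:] = [:- y, 1:] * [:y\<^sup>2 + 3 * c, y, 1:]" by (simp add: power2_eq_square)
    then have "is_unit [:- y, 1:] \<or> is_unit [:y\<^sup>2 + 3 * c, y, 1:]" using irr by (auto simp: irreducible_def)
    then show False by (simp add: is_unit_iff_degree)
  qed
  then have "\<not> irreducible (gen_laguerre 3 (- 3 - c))"
    unfolding gen_laguerre_3 by (simp add: irreducible_shift_iff)
  moreover have "y^3 / (3 * y + 2) \<ge> y / 5"
  proof -
    have "y * 1 \<le> y * y" using y(1) by (intro mult_left_mono) auto
    then have "3 * y + 2 \<le> 5 * (y * y)" using y(1) by linarith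
    then have "y * (3 * y + 2) \<le> y * (5 * (y * y))" using y(1) by (intro mult_left_mono) auto
    then have "(y / 5) * (3 * y + 2) \<le> y^3" by (simp add: power3_eq_cube)
    then show ?thesis using y(1) by (simp add: pos_le_divide_eq)
  qed
  then have "of_nat N + 3 \<le> - c" using y(2) by (simp only: c_def minus_minus)
  then have "of_nat N \<le> \<bar>- 3 - c\<bar>" by linarith
  ultimately show "\<exists>x\<in>{\<alpha>. \<not> irreducible (gen_laguerre 3 \<alpha>)}. of_nat N \<le> \<bar>x\<bar>" by blast
qed

text \<open>Points of the elliptic curve \<open>y\<^sup>2 = x (x\<^sup>2 + 40 x - 32)\<close> whose first coordinate has
  2-adic valuation \<open>-2 k\<close>. Doubling such a point increases \<open>k\<close> by one, starting from the
  point with \<open>x = 121 / 4\<close>.\<close>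
definition curve_point :: "nat \<Rightarrow> rat \<Rightarrow> bool" where
  "curve_point k x \<longleftrightarrow> (\<exists>a b :: int. odd a \<and> odd b \<and> x * 4 ^ k * of_int b = of_int a) \<and>
     (\<exists>y. y\<^sup>2 = x * (x\<^sup>2 + 40 * x - 32))"

text \<open>Clearing the denominator \<open>P\<close> turns x, x^2 + 40 x - 32 and x + 2 into odd
  integers, so none of them vanishes.\<close>

lemma curve_point_coords:
  assumes k: "k \<ge> 1" and ab: "odd a" "odd b" "x * 4 ^ k * of_int b = of_int a"
  defines "P \<equiv> of_int (4 ^ k * b) :: rat"
  shows "P \<noteq> 0" "x = of_int a / P" "P\<^sup>2 * (x\<^sup>2 + 40 * x - 32) = of_int (a\<^sup>2 + 40 * a * (4 ^ k * b) - 32 * (4 ^ k * b)\<^sup>2)"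
    "odd (a\<^sup>2 + 40 * a * (4 ^ k * b) - 32 * (4 ^ k * b)\<^sup>2)" "x \<noteq> 0" "x\<^sup>2 + 40 * x - 32 \<noteq> 0" "x + 2 \<noteq> 0"
proof -
  have b0: "b \<noteq> 0" using ab by auto
  show P0: "P \<noteq> 0" using b0 by (simp add: P_def)
  show x: "x = of_int a / P" using ab(3) b0 by (simp add: P_def field_simps)
  then have XP: "P * x = of_int a" using P0 by simp
  have "P\<^sup>2 * (x\<^sup>2 + 40 * x - 32) = (P * x)\<^sup>2 + 40 * (P * x) * P - 32 * P\<^sup>2"
    by (simp add: power2_eq_square algebra_simps)
  then show eq: "P\<^sup>2 * (x\<^sup>2 + 40 * x - 32) = of_int (a\<^sup>2 + 40 * a * (4 ^ k * b) - 32 * (4 ^ k * b)\<^sup>2)"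
    unfolding XP by (simp add: P_def)
  show oddD: "odd (a\<^sup>2 + 40 * a * (4 ^ k * b) - 32 * (4 ^ k * b)\<^sup>2)" using ab by simp
  show "x \<noteq> 0" using XP ab by auto
  show "x\<^sup>2 + 40 * x - 32 \<noteq> 0"
  proof
    assume "x\<^sup>2 + 40 * x - 32 = 0"
    then have "of_int (a\<^sup>2 + 40 * a * (4 ^ k * b) - 32 * (4 ^ k * b)\<^sup>2) = (0 :: rat)" using eq by simp
    then show False using oddD by (metis dvd_0_right of_int_eq_0_iff)
  qed
  show "x + 2 \<noteq> 0"
  proof
    assume "x + 2 = 0"
    then have "P * x + 2 * P = 0" by (simp flip: distrib_left add: mult.commute[of 2])
    then have "of_int (a + 2 * (4 ^ k * b)) = (0 :: rat)" unfolding XP by (simp add: P_def)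
    then have "a + 2 * (4 ^ k * b) = 0" by (simp only: of_int_eq_0_iff)
    moreover have "odd (a + 2 * (4 ^ k * b))" using ab by simp
    ultimately show False by simp
  qed
qed

lemma curve_point_double:
  assumes k: "k \<ge> 1" and x: "curve_point k x" shows "\<exists>x'. curve_point (Suc k) x'"
proof -
  obtain a b where ab: "odd a" "odd b" "x * 4 ^ k * of_int b = of_int a" using x by (auto simp: curve_point_def)
  obtain y where y: "y\<^sup>2 = x * (x\<^sup>2 + 40 * x - 32)" using x by (auto simp: curve_point_def)
  note co = curve_point_coords[OF k ab]
  define P where "P = (of_int (4 ^ k * b) :: rat)"
  define m where "m = a\<^sup>2 + 40 * a * (4 ^ k * b) - 32 * (4 ^ k * b)\<^sup>2"
  have m: "P\<^sup>2 * (x\<^sup>2 + 40 * x - 32) = of_int m" "odd m" using co(3,4) by (simp_all add: P_def m_def)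
  have XP: "P * x = of_int a" and P0: "P \<noteq> 0" using co(1,2) by (simp_all add: P_def)
  have Y0: "y \<noteq> 0"
  proof -
    have "y\<^sup>2 \<noteq> 0" unfolding y mult_eq_0_iff using co(5,6) by blast
    then show ?thesis by simp
  qed
  \<comment> \<open>The duplication formula on y^2 = x (x^2 + A x + B) has first coordinate ((x^2 -
    B) / (2 y))^2, here with B = - 32.\<close>
  define x' where "x' = ((x\<^sup>2 + 32) / (2 * y))\<^sup>2"
  define y' where "y' = (x\<^sup>2 + 32) * (x^4 + 80 * x^3 - 192 * x\<^sup>2 - 2560 * x + 1024) / (8 * y^3)"
  define D where "D = 4 * y\<^sup>2"
  have D0: "D \<noteq> 0" using Y0 by (simp add: D_def)
  have D: "D = 4 * (x * (x\<^sup>2 + 40 * x - 32))" "D \<noteq> 0" by (simp add: D_def y) (rule D0)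
  have x'D: "x' = (x\<^sup>2 + 32)\<^sup>2 / D" by (simp add: x'_def D_def power_divide power_mult_distrib)
  have "D^3 = (8 * y^3)\<^sup>2" by (simp add: D_def power_mult_distrib flip: power_mult)
  then have y'2: "y'\<^sup>2 * D^3 = ((x\<^sup>2 + 32) * (x^4 + 80 * x^3 - 192 * x\<^sup>2 - 2560 * x + 1024))\<^sup>2"
    using Y0 by (simp add: y'_def power_divide)
  have "x' * (x'\<^sup>2 + 40 * x' - 32) * D^3 = (x\<^sup>2 + 32)\<^sup>2 * ((x\<^sup>2 + 32)^4 + 40 * (x\<^sup>2 + 32)\<^sup>2 * D - 32 * D\<^sup>2)"
  proof -
    have XD: "x' * D = (x\<^sup>2 + 32)\<^sup>2" using D(2) by (simp add: x'D)
    have "x' * (x'\<^sup>2 + 40 * x' - 32) * D^3 = (x' * D) * ((x' * D)\<^sup>2 + 40 * (x' * D) * D - 32 * D\<^sup>2)"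
      by (simp add: power2_eq_square power3_eq_cube algebra_simps)
    then show ?thesis unfolding XD by (simp flip: power_mult)
  qed
  \<comment> \<open>That the right side is a square is the formula for the second coordinate of the
    double.\<close>
  also have "(x\<^sup>2 + 32)^4 + 40 * (x\<^sup>2 + 32)\<^sup>2 * D - 32 * D\<^sup>2 = (x^4 + 80 * x^3 - 192 * x\<^sup>2 - 2560 * x + 1024)\<^sup>2"
    unfolding D(1) by (simp add: eval_nat_numeral algebra_simps)
  finally have "y'\<^sup>2 * D^3 = x' * (x'\<^sup>2 + 40 * x' - 32) * D^3" using y'2 by (simp add: power_mult_distrib)
  then have y': "y'\<^sup>2 = x' * (x'\<^sup>2 + 40 * x' - 32)" using D(2) by simp
  \<comment> \<open>Valuations: x^2 + 32 has -4k and \<open>D\<close> = 4 y^2 has 2 - 6k, so x' has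
    -2k - 2. The odd integers \<open>A\<close>, \<open>a\<close>, \<open>m\<close> and
    \<open>b\<close> express this without a valuation function.\<close>
  define A where "A = a\<^sup>2 + 32 * (4 ^ k * b)\<^sup>2"
  have "P\<^sup>2 * (x\<^sup>2 + 32) = (P * x)\<^sup>2 + 32 * P\<^sup>2" by (simp add: power2_eq_square algebra_simps)
  then have A: "P\<^sup>2 * (x\<^sup>2 + 32) = of_int A" unfolding XP by (simp add: A_def P_def)
  have "x' * D * P^4 = (P\<^sup>2 * (x\<^sup>2 + 32))\<^sup>2" using D(2) by (simp add: x'D power_mult_distrib flip: power_mult)
  then have 1: "x' * D * P^4 = of_int (A\<^sup>2)" unfolding A by simp
  have "D * P^3 = 4 * ((P * x) * (P\<^sup>2 * (x\<^sup>2 + 40 * x - 32)))"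
    unfolding D(1) by (simp add: power2_eq_square power3_eq_cube algebra_simps)
  then have 2: "D * P^3 = of_int (4 * a * m)" unfolding XP m(1) by simp
  have "x' * D * P^4 = x' * (D * P^3) * P" by (simp add: eval_nat_numeral)
  also have "\<dots> = x' * of_int (4 * a * m) * of_int (4 ^ k * b)" unfolding 2 by (simp add: P_def)
  also have "\<dots> = x' * 4 ^ Suc k * of_int (a * m * b)" by simp
  finally have "x' * 4 ^ Suc k * of_int (a * m * b) = of_int (A\<^sup>2)" using 1 by simp
  moreover have "odd (a * m * b)" "odd (A\<^sup>2)" using ab m(2) by (simp_all add: A_def)
  ultimately have "curve_point (Suc k) x'" unfolding curve_point_def using y' by blast
  then show ?thesis by blast
qed

lemma curve_point_exists:
  assumes "k \<ge> 1" shows "\<exists>x. curve_point k x"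
  using assms
proof (induction k rule: dec_induct)
  case base
  \<comment> \<open>Up to sign of y, the starting point is the double of (1, 3).\<close>
  have "odd (121 :: int)" "odd (1 :: int)" "(121 / 4 :: rat) * 4 ^ 1 * of_int 1 = of_int 121" by simp_all
  moreover have "(2013 / 8 :: rat)\<^sup>2 = 121 / 4 * ((121 / 4)\<^sup>2 + 40 * (121 / 4) - 32)"
    by (simp add: power2_eq_square)
  ultimately have "curve_point 1 (121 / 4)" unfolding curve_point_def by blast
  then show ?case by blast
next
  case (step k)
  then show ?case using curve_point_double by blast
qed

text \<open>A curve point \<open>(x, y)\<close> gives the resolvent root \<open>w = (6 x / y)\<^sup>2\<close> for the parameter
  \<open>c = - 54 x\<^sup>2 / ((x\<^sup>2 + 40 x - 32) (x + 2))\<close>, whose 2-adic valuation is \<open>2 k + 1\<close>.\<close>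
lemma reducible_gen_laguerre_4: "infinite {\<alpha> :: rat. \<not> irreducible (gen_laguerre 4 \<alpha>)}"
proof -
  have "\<exists>c :: rat. \<not> irreducible (quartic c) \<and> (\<exists>A B :: int. odd A \<and> odd B \<and> c * of_int B = of_int (2 * 4 ^ Suc k * A))" for k
  proof -
    obtain x where x: "curve_point (Suc k) x" using curve_point_exists[of "Suc k"] by auto
    obtain a b where ab: "odd a" "odd b" "x * 4 ^ Suc k * of_int b = of_int a" using x by (auto simp: curve_point_def)
    obtain y where y: "y\<^sup>2 = x * (x\<^sup>2 + 40 * x - 32)" using x by (auto simp: curve_point_def)
    define P where "P = (of_int (4 ^ Suc k * b) :: rat)"
    define m where "m = a\<^sup>2 + 40 * a * (4 ^ Suc k * b) - 32 * (4 ^ Suc k * b)\<^sup>2"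
    define D where "D = x\<^sup>2 + 40 * x - 32"
    \<comment> \<open>With w = 36 x / D and s = 3 (x^2 + 32) / D, this is the solution w (3 - 6 w +
      s) / (2 (3 w - 2)) of the resolvent equation in c; a factor x - 16 cancels.\<close>
    define c where "c = - 54 * x\<^sup>2 / (D * (x + 2))"
    have m: "P\<^sup>2 * D = of_int m" "odd m"
      using curve_point_coords(3,4)[OF _ ab] by (simp_all add: P_def m_def D_def)
    have P: "P \<noteq> 0" "x = of_int a / P" and nz: "x \<noteq> 0" "D \<noteq> 0" "x + 2 \<noteq> 0"
      using curve_point_coords(1,2,5,6,7)[OF _ ab] by (simp_all add: P_def D_def)
    then have XP: "P * x = of_int a" by simp
    have Y0: "y \<noteq> 0" using y nz by (auto simp: D_def)
    \<comment> \<open>This is a = 2 (6 x / y), since w = a^2 / 4 in the factorization of the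
      quartic.\<close>
    define z where "z = 12 * x / y"
    define u where "u = 144 * x / D"
    have "z\<^sup>2 = 144 * x\<^sup>2 / (x * D)" by (simp add: z_def power_divide power_mult_distrib y D_def)
    then have z2: "z\<^sup>2 = u" using nz by (simp add: u_def power2_eq_square)
    have uD: "u * D = 144 * x" and cD: "c * (D * (x + 2)) = - 54 * x\<^sup>2"
      using nz by (simp_all add: u_def c_def)
    have "(u^3 + 12 * c * u\<^sup>2 + 24 * c * (c - 1) * u - 64 * c\<^sup>2) * (D^3 * (x + 2)\<^sup>2) =
      (u * D)^3 * (x + 2)\<^sup>2 + 12 * (c * (D * (x + 2))) * (u * D)\<^sup>2 * (x + 2) +
      24 * (c * (D * (x + 2)))\<^sup>2 * (u * D) - 24 * (c * (D * (x + 2))) * (u * D) * D * (x + 2) -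
      64 * (c * (D * (x + 2)))\<^sup>2 * D"
      by (simp add: eval_nat_numeral algebra_simps)
    also have "\<dots> = 0" unfolding uD cD unfolding D_def by (simp add: eval_nat_numeral algebra_simps)
    finally have "u^3 + 12 * c * u\<^sup>2 + 24 * c * (c - 1) * u - 64 * c\<^sup>2 = 0" using nz by simp
    moreover have "z \<noteq> 0" using nz Y0 by (simp add: z_def)
    ultimately have red: "\<not> irreducible (quartic c)" using reducible_quartic[of z c] by (simp add: z2)
    have "c * ((P\<^sup>2 * D) * (P * x + 2 * P)) = P^3 * (c * (D * (x + 2)))"
      by (simp add: eval_nat_numeral algebra_simps)
    also have "\<dots> = - 54 * (P * x)\<^sup>2 * P" unfolding cD by (simp add: eval_nat_numeral algebra_simps)
    finally have "c * of_int (m * (a + 2 * (4 ^ Suc k * b))) = of_int (2 * 4 ^ Suc k * (- 27 * a\<^sup>2 * b))"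
      unfolding XP m(1) by (simp add: P_def)
    moreover have "odd (m * (a + 2 * (4 ^ Suc k * b)))" "odd (- 27 * a\<^sup>2 * b)" using ab m(2) by simp_all
    ultimately show ?thesis using red by blast
  qed
  then obtain c :: "nat \<Rightarrow> rat" where c: "\<And>k. \<not> irreducible (quartic (c k))"
    "\<And>k. \<exists>A B :: int. odd A \<and> odd B \<and> c k * of_int B = of_int (2 * 4 ^ Suc k * A)" by metis
  have neq: "c k \<noteq> c l" if "k < l" for k l
  proof
    assume eq: "c k = c l"
    obtain A B where A: "odd A" "odd B" "c k * of_int B = of_int (2 * 4 ^ Suc k * A)" using c(2) by blast
    obtain A' B' where A': "odd A'" "odd B'" "c l * of_int B' = of_int (2 * 4 ^ Suc l * A')" using c(2) by blast
    have "c k * of_int B * of_int B' = c l * of_int B' * of_int B" by (simp add: eq)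
    then have "of_int (2 * 4 ^ Suc k * A * B') = (of_int (2 * 4 ^ Suc l * A' * B) :: rat)" unfolding A A' by simp
    then have "2 * 4 ^ Suc k * A * B' = 2 * 4 ^ Suc l * A' * B" by (simp only: of_int_eq_iff)
    moreover have "4 ^ Suc l = 4 ^ Suc k * (4 ^ (l - k) :: int)" using that by (simp flip: power_add)
    ultimately have "A * B' = 4 ^ (l - k) * A' * B" by simp
    then have "even (A * B')" using that by simp
    then show False using A A' by simp
  qed
  have "inj c"
  proof (rule injI)
    fix k l assume "c k = c l" then show "k = l" using neq[of k l] neq[of l k] by (cases k l rule: linorder_cases) auto
  qed
  then have "inj (\<lambda>k. - 4 - c k)" by (simp add: inj_def)
  then have "infinite (range (\<lambda>k. - 4 - c k))" by (rule range_inj_infinite)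
  moreover have "gen_laguerre 4 (- 4 - d) = smult (1 / 24) (pcompose (quartic d) [:d, 1:])" for d
    unfolding gen_laguerre_4 by (simp add: quartic_def)
  then have "range (\<lambda>k. - 4 - c k) \<subseteq> {\<alpha>. \<not> irreducible (gen_laguerre 4 \<alpha>)}"
    using c(1) by (auto simp: irreducible_shift_iff)
  ultimately show ?thesis by (rule infinite_super[rotated])
qed

text \<open>Rational points of the conic: \<open>w = j (2j + 3) / (3j\<^sup>2 + 6j + 2)\<close> and \<open>c = j w\<close>.
  Taking \<open>j\<close> congruent to 1 modulo 8 keeps \<open>w\<close> from being a square.\<close>
lemma not_alternating_gen_laguerre_4:
  "infinite {\<alpha> :: rat. irreducible (gen_laguerre 4 \<alpha>) \<and>
     \<not> alternating_on (complex_roots (gen_laguerre 4 \<alpha>)) \<subseteq> galois_group (gen_laguerre 4 \<alpha>)}"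
proof (rule infinite_of_unbounded)
  fix N :: nat
  define j :: int where "j = 8 * int N + 1"
  define n d where "n = j * (2 * j + 3)" and "d = 3 * j\<^sup>2 + 6 * j + 2"
  define m :: rat where "m = of_int j"
  have m: "m \<ge> 1" "m = 8 * of_nat N + 1" by (simp_all add: m_def j_def)
  define D where "D = 3 * m\<^sup>2 + 6 * m + 2"
  have D0: "D > 0" using m by (simp add: D_def add_pos_nonneg)
  \<comment> \<open>Putting c = m w in the resolvent equation and dividing by w^2 leaves an equation
    linear in w: \<open>w * D = m * (2 * m + 3)\<close>.\<close>
  define w where "w = m * (2 * m + 3) / D"
  have wD: "w * D = m * (2 * m + 3)" using D0 by (simp add: w_def)
  have w0: "w > 0" using m D0 by (simp add: w_def)
  define c where "c = m * w"
  have c0: "c > 0" using w0 m by (simp add: c_def)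
  have factor: "2 * v^3 + 6 * c * v\<^sup>2 + 3 * c * (c - 1) * v - 2 * c\<^sup>2 =
      (v - w) * (2 * v\<^sup>2 + (6 * m + 2) * w * v + 2 * m\<^sup>2 * w)" for v
  proof -
    have "2 * v^3 + 6 * c * v\<^sup>2 + 3 * c * (c - 1) * v - 2 * c\<^sup>2 -
        (v - w) * (2 * v\<^sup>2 + (6 * m + 2) * w * v + 2 * m\<^sup>2 * w) = w * v * (w * D - m * (2 * m + 3))"
      by (simp add: c_def D_def eval_nat_numeral algebra_simps)
    then show ?thesis using wD by simp
  qed
  have irr: "irreducible (quartic c)"
  proof (rule irreducible_quartic[OF c0])
    fix a
    show "(a\<^sup>2)^3 + 12 * c * (a\<^sup>2)\<^sup>2 + 24 * c * (c - 1) * a\<^sup>2 - 64 * c\<^sup>2 \<noteq> 0"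
    proof
      assume res: "(a\<^sup>2)^3 + 12 * c * (a\<^sup>2)\<^sup>2 + 24 * c * (c - 1) * a\<^sup>2 - 64 * c\<^sup>2 = 0"
      define v where "v = (a / 2)\<^sup>2"
      have a2: "a\<^sup>2 = 4 * v" by (simp add: v_def power_divide)
      have "32 * (2 * v^3 + 6 * c * v\<^sup>2 + 3 * c * (c - 1) * v - 2 * c\<^sup>2) = 0"
        using res unfolding a2 by (simp add: power_mult_distrib)
      then have "(v - w) * (2 * v\<^sup>2 + (6 * m + 2) * w * v + 2 * m\<^sup>2 * w) = 0" unfolding factor by simp
      moreover have "v \<ge> 0" by (simp add: v_def)
      \<comment> \<open>The cofactor has no nonnegative root, so w is the only resolvent root that
        could be a rational square.\<close>
      then have "2 * v\<^sup>2 + (6 * m + 2) * w * v + 2 * m\<^sup>2 * w > 0"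
        using w0 m by (intro add_nonneg_pos add_nonneg_nonneg mult_nonneg_nonneg mult_pos_pos) auto
      ultimately have "v = w" by simp
      then have "(a / 2 * D)\<^sup>2 = w * D * D" by (simp add: v_def power_mult_distrib power2_eq_square)
      also have "\<dots> = of_int (n * d)" unfolding wD by (simp add: n_def d_def D_def m_def)
      finally have sq: "(a / 2 * D)\<^sup>2 = of_int (n * d)" .
      then have "poly [:- of_int (n * d), 0, 1:] (a / 2 * D) = 0" by (simp add: power2_eq_square)
      then obtain t where "a / 2 * D = of_int t"
        by (rule rational_root_int[rotated 2]) (auto simp: coeff_pCons split: nat.split)
      then have "of_int (t\<^sup>2) = (of_int (n * d) :: rat)" using sq by simp
      then have t: "t\<^sup>2 = n * d" by (simp only: of_int_eq_iff)
      \<comment> \<open>As \<open>j\<close> is 1 modulo 8, \<open>n\<close> is 5 and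
        \<open>d\<close> is 3, so \<open>n * d\<close> is 7 modulo 8, which is not a quadratic
        residue; yet w being a square would make \<open>n * d\<close> one.\<close>
      define i A B where "i = int N" and "A = 16 * i\<^sup>2 + 7 * i" and "B = 24 * i\<^sup>2 + 12 * i + 1"
      have "n = 8 * A + 5" "d = 8 * B + 3"
        by (simp_all add: n_def d_def j_def i_def A_def B_def power2_eq_square algebra_simps)
      then have "n * d = 7 + 8 * (8 * A * B + 3 * A + 5 * B + 1)" by (simp add: algebra_simps)
      then obtain q where "n * d = 7 + 8 * q" by blast
      then have "(n * d) mod 8 = 7" by simp
      moreover have "t\<^sup>2 mod 8 \<noteq> 7"
      proof -
        have "t\<^sup>2 mod 8 = (t mod 8)\<^sup>2 mod 8" by (simp add: power_mod)
        moreover have "t mod 8 \<in> {0, 1, 2, 3, 4, 5, 6, 7}" by auto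
        ultimately show ?thesis by (elim insertE emptyE) simp_all
      qed
      ultimately show False using t by simp
    qed
  qed
  have "gen_laguerre 4 (- 4 - c) = smult (1 / 24) (pcompose (quartic c) [:c, 1:])"
    unfolding gen_laguerre_4 by (simp add: quartic_def)
  moreover have "poly (resolvent c) (16 * w) = 0" unfolding poly_resolvent factor by simp
  ultimately have "irreducible (gen_laguerre 4 (- 4 - c)) \<and>
     \<not> alternating_on (complex_roots (gen_laguerre 4 (- 4 - c))) \<subseteq> galois_group (gen_laguerre 4 (- 4 - c))"
    using quartic_not_alternating[OF irr, of "16 * w" "1 / 24" c] irreducible_shift[OF irr, of "1 / 24" c] by simp
  moreover have "of_nat N \<le> \<bar>- 4 - c\<bar>"
  proof -
    \<comment> \<open>Since w \<ge> 1/3, the parameter c = m w is at least (8 N + 1) / 3, so it is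
      unbounded.\<close>
    have "m * 1 \<le> m * m" using m(1) by (intro mult_left_mono) auto
    moreover have "3 * (m * (2 * m + 3)) - D = 3 * (m * m) + 3 * m - 2"
      by (simp add: D_def power2_eq_square algebra_simps)
    ultimately have "D \<le> 3 * (m * (2 * m + 3))" using m(1) by linarith
    then have "1 / 3 \<le> w" using D0 by (simp add: w_def pos_le_divide_eq)
    then have "m * (1 / 3) \<le> c" unfolding c_def using m(1) by (intro mult_left_mono) auto
    moreover have "of_nat N \<le> m * (1 / 3)" unfolding m(2) by simp
    ultimately show ?thesis by simp
  qed
  ultimately show "\<exists>x\<in>{\<alpha>. irreducible (gen_laguerre 4 \<alpha>) \<and>
     \<not> alternating_on (complex_roots (gen_laguerre 4 \<alpha>)) \<subseteq> galois_group (gen_laguerre 4 \<alpha>)}. of_nat N \<le> \<bar>x\<bar>"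
    by blast
qed

theorem theorem6p3:
  shows "(\<forall>n r :: nat. 1 \<le> n \<and> n \<le> 4 \<longrightarrow>
            laguerre_r n r =
              (\<Sum>j\<le>n. Polynomial.monom (of_nat ((n - j + r) choose (n - j)) / fact j) j) \<and>
            comm_semiring_1_class.irreducible (laguerre_r n r) \<and>
            alternating_on (complex_roots (laguerre_r n r)) \<subseteq> galois_group (laguerre_r n r) \<and>
            (n \<le> 3 \<longrightarrow>
              galois_group (laguerre_r n r) = symmetric_on (complex_roots (laguerre_r n r))))
       \<and> (\<forall>n \<in> {2, 3, 4 :: nat}.
            infinite {\<alpha> :: rat. \<not> comm_semiring_1_class.irreducible (gen_laguerre n \<alpha>)})
       \<and> infinite {\<alpha> :: rat. comm_semiring_1_class.irreducible (gen_laguerre 4 \<alpha>) \<and>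
            \<not> alternating_on (complex_roots (gen_laguerre 4 \<alpha>)) \<subseteq> galois_group (gen_laguerre 4 \<alpha>)}"
  using laguerre_r_irreducible_galois laguerre_r_eq reducible_gen_laguerre_2 reducible_gen_laguerre_3
    reducible_gen_laguerre_4 not_alternating_gen_laguerre_4
  by blast

end
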